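(* Let $\mathcal{H}$ be a separable Hilbert space and $K\in\mathcal{L}(\mathcal{H})$. Let $\{\mathcal{W}_i\}_{i\in I}$ be a family of closed subspaces of $\mathcal{H}$ and $\{v_i\}_{i\in I}$ a family of positive weights. Then $\{(\mathcal{W}_i,v_i)\}_{i\in I}$ is a $K$-fusion frame for $\mathcal{H}$ if and only if there exists a bounded linear operator $L:\left(\sum_{i\in I}\oplus\mathcal{W}_i\right)_{l^2}\to\mathcal{H}$ such that $Le_n=\sum_{i\in I}v_ie_n^i$ and $R(K)\subseteq R(L)$, where $\{e_n\}_{n=1}^\infty$ is an orthonormal basis in $\left(\sum_{i\in I}\oplus\mathcal{W}_i\right)_{l^2}$ and $e_n^i$ is the $i$-th component of $e_n$.
   Context: The index set $I$ is finite or countable. $\mathcal{L}(\mathcal{H})$ is the space of bounded linear operators on $\mathcal{H}$; $R(T)$ is the range of $T$; $P_{\mathcal{W}}$ denotes the orthogonal projection of $\mathcal{H}$ onto the closed subspace $\mathcal{W}$. Put $\left(\sum_{i\in I}\oplus\mathcal{W}_i\right)_{l^2}=\{\{f_i\}_{i\in I}: f_i\in\mathcal{W}_i,\ \sum_{i\in I}\|f_i\|^2<\infty\}$, with inner product $\langle\{f_i\},\{g_i\}\rangle=\sum_{i\in I}\langle f_i,g_i\rangle_{\mathcal{H}}$. $\{(\mathcal{W}_i,v_i)\}_{i\in I}$ is a $K$-fusion frame for $\mathcal{H}$ if there are constants $A,B>0$ with $A\|K^*f\|^2\le\sum_{i\in I}v_i^2\|P_{\mathcal{W}_i}f\|^2\le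 B\|f\|^2$ for all $f\in\mathcal{H}$.
   Formalization: The condition Le_n = sum v_i e_n^i is required of L for every orthonormal basis {e_n} (finite bases allowed); with a single fixed basis the "if" part fails, e.g. H = W_i = R, v_i = 1, K = id, Lf = f_0 and a basis of delta_0 plus finitely supported zero-sum vectors. *)

theory Defs
  imports "HOL-Analysis.Analysis"
begin

text \<open>
  The library has no Hilbert spaces over the complex numbers (\<^class>\<open>real_inner\<close> is real), so
  real and complex Hilbert spaces are treated together.  The scalar field is a complete normed field
  with a conjugation; by the Gelfand--Mazur theorem the only models are, up to isometric
  isomorphism, the real numbers with the identity and the complex numbers with \<^const>\<open>cnj\<close>.
\<close>

class real_or_complex = real_normed_field + banach +
  fixes conjg :: "'a \<Rightarrow> 'a"
  assumes conjg_add: "conjg (x + y) = conjg x + conjg y"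
    and mult_conjg: "x * conjg x = (norm x)\<^sup>2 *\<^sub>R 1"

instantiation real :: real_or_complex
begin
definition conjg_real :: "real \<Rightarrow> real" where "conjg_real x = x"
instance by standard (simp_all add: conjg_real_def power2_eq_square)
end

instantiation complex :: real_or_complex
begin
definition conjg_complex :: "complex \<Rightarrow> complex" where "conjg_complex = cnj"
instance by standard (simp_all add: conjg_complex_def complex_mult_cnj cmod_power2 complex_eq_iff)
end

locale hilbert_space = vector_space smul
  for smul :: "'k::real_or_complex \<Rightarrow> 'h::banach \<Rightarrow> 'h" +
  fixes ip :: "'h \<Rightarrow> 'h \<Rightarrow> 'k"
  assumes smul_of_real: "smul (of_real r) x = r *\<^sub>R x"
    and ip_add_left: "ip (x + y) z = ip x z + ip y z"
    and ip_smul_left: "ip (smul a x) y = a * ip x y"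
    and ip_commute: "ip y x = conjg (ip x y)"
    and ip_self: "ip x x = of_real ((norm x)\<^sup>2)"

lemma hilbert_space_real:
  "hilbert_space (scaleR :: real \<Rightarrow> 'h \<Rightarrow> 'h::{real_inner, banach}) inner"
  by standard
    (simp_all add: algebra_simps inner_add_left inner_commute conjg_real_def power2_norm_eq_inner)

lemma hilbert_space_complex: "hilbert_space (*) (\<lambda>x y :: complex. x * cnj y)"
  by standard
    (simp_all add: algebra_simps scaleR_conv_of_real conjg_complex_def complex_mult_cnj cmod_power2 complex_eq_iff)

definition bounded_op :: "('k::real_or_complex \<Rightarrow> 'h::banach \<Rightarrow> 'h) \<Rightarrow> ('h \<Rightarrow> 'h) \<Rightarrow> bool" where
  "bounded_op smul T \<longleftrightarrow> bounded_linear T \<and> (\<forall>a x. T (smul a x) = smul a (T x))"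

definition closed_subspace :: "('k::real_or_complex \<Rightarrow> 'h::banach \<Rightarrow> 'h) \<Rightarrow> 'h set \<Rightarrow> bool" where
  "closed_subspace smul W \<longleftrightarrow> module.subspace smul W \<and> closed W"

definition adjoint_op :: "('h::banach \<Rightarrow> 'h \<Rightarrow> 'k::real_or_complex) \<Rightarrow> ('h \<Rightarrow> 'h) \<Rightarrow> 'h \<Rightarrow> 'h" where
  "adjoint_op ip T = (THE S. \<forall>x y. ip (T x) y = ip x (S y))"

definition orth_proj :: "('h::banach \<Rightarrow> 'h \<Rightarrow> 'k::real_or_complex) \<Rightarrow> 'h set \<Rightarrow> 'h \<Rightarrow> 'h" where
  "orth_proj ip W f = (THE p. p \<in> W \<and> (\<forall>w\<in>W. ip (f - p) w = 0))"

definition K_fusion_frame ::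
  "('h::banach \<Rightarrow> 'h \<Rightarrow> 'k::real_or_complex) \<Rightarrow> ('h \<Rightarrow> 'h) \<Rightarrow> 'i set \<Rightarrow> ('i \<Rightarrow> 'h set) \<Rightarrow> ('i \<Rightarrow> real) \<Rightarrow> bool"
  where
  "K_fusion_frame ip K I W v \<longleftrightarrow>
     (\<exists>A>0. \<exists>B>0. \<forall>f.
        (\<lambda>i. (v i)\<^sup>2 * (norm (orth_proj ip (W i) f))\<^sup>2) summable_on I \<and>
        A * (norm (adjoint_op ip K f))\<^sup>2 \<le> (\<Sum>\<^sub>\<infinity>i\<in>I. (v i)\<^sup>2 * (norm (orth_proj ip (W i) f))\<^sup>2) \<and>
        (\<Sum>\<^sub>\<infinity>i\<in>I. (v i)\<^sup>2 * (norm (orth_proj ip (W i) f))\<^sup>2) \<le> B * (norm f)\<^sup>2)"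

text \<open>
  Families indexed by \<open>I\<close> are functions on the whole index type that vanish outside \<open>I\<close>, so that
  the direct sum is a space of functions under the pointwise operations.
\<close>

definition l2_sum :: "'i set \<Rightarrow> ('i \<Rightarrow> 'h::banach set) \<Rightarrow> ('i \<Rightarrow> 'h) set" where
  "l2_sum I W =
     {f. (\<forall>i\<in>I. f i \<in> W i) \<and> (\<forall>i. i \<notin> I \<longrightarrow> f i = 0) \<and> (\<lambda>i. (norm (f i))\<^sup>2) summable_on I}"

definition l2_ip ::
  "('h::banach \<Rightarrow> 'h \<Rightarrow> 'k::real_or_complex) \<Rightarrow> 'i set \<Rightarrow> ('i \<Rightarrow> 'h) \<Rightarrow> ('i \<Rightarrow> 'h) \<Rightarrow> 'k" where
  "l2_ip ip I f g = (\<Sum>\<^sub>\<infinity>i\<in>I. ip (f i) (g i))"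

definition l2_norm :: "'i set \<Rightarrow> ('i \<Rightarrow> 'h::banach) \<Rightarrow> real" where
  "l2_norm I f = sqrt (\<Sum>\<^sub>\<infinity>i\<in>I. (norm (f i))\<^sup>2)"

definition l2_bounded_op ::
  "('k::real_or_complex \<Rightarrow> 'h::banach \<Rightarrow> 'h) \<Rightarrow> 'i set \<Rightarrow> ('i \<Rightarrow> 'h set) \<Rightarrow> (('i \<Rightarrow> 'h) \<Rightarrow> 'h) \<Rightarrow> bool"
  where
  "l2_bounded_op smul I W L \<longleftrightarrow>
     (\<forall>f\<in>l2_sum I W. \<forall>g\<in>l2_sum I W. L (\<lambda>i. f i + g i) = L f + L g) \<and>
     (\<forall>a. \<forall>f\<in>l2_sum I W. L (\<lambda>i. smul a (f i)) = smul a (L f)) \<and>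
     (\<exists>C. \<forall>f\<in>l2_sum I W. norm (L f) \<le> C * l2_norm I f)"

text \<open>
  An orthonormal basis is an orthonormal family with dense linear span.  It is indexed by a set \<open>N\<close>
  of natural numbers, because the direct sum may be finite-dimensional.
\<close>

definition l2_orthonormal_basis ::
  "('k::real_or_complex \<Rightarrow> 'h::banach \<Rightarrow> 'h) \<Rightarrow> ('h \<Rightarrow> 'h \<Rightarrow> 'k) \<Rightarrow> 'i set \<Rightarrow> ('i \<Rightarrow> 'h set) \<Rightarrow>
   nat set \<Rightarrow> (nat \<Rightarrow> 'i \<Rightarrow> 'h) \<Rightarrow> bool" where
  "l2_orthonormal_basis smul ip I W N e \<longleftrightarrow>
     (\<forall>n\<in>N. e n \<in> l2_sum I W) \<and>
     (\<forall>m\<in>N. \<forall>n\<in>N. l2_ip ip I (e m) (e n) = (if m = n then 1 else 0)) \<and>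
     (\<forall>f\<in>l2_sum I W. \<forall>\<epsilon>>0. \<exists>F c. finite F \<and> F \<subseteq> N \<and>
        l2_norm I (\<lambda>i. f i - (\<Sum>n\<in>F. smul (c n) (e n i))) < \<epsilon>)"

end

theory Submission
  imports Defs
begin

text \<open>
  With \<open>T f = (v\<^sub>i P\<^sub>i f)\<^sub>i\<close> the analysis operator, a \<open>K\<close>-fusion frame is given by
  \<open>A \<parallel>K\<^sup>* f\<parallel>\<^sup>2 \<le> \<parallel>T f\<parallel>\<^sup>2 \<le> B \<parallel>f\<parallel>\<^sup>2\<close>; the operator \<open>L\<close> of the theorem is the adjoint of \<open>T\<close>, so that
  the equivalence is a case of Douglas' range inclusion theorem.  If the bounds hold, then
  \<open>K x\<close> is obtained as \<open>L g\<close> with \<open>g\<close> the limit of \<open>T f\<^sub>n\<close>, where \<open>f\<^sub>n\<close> is a minimising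
  sequence of \<open>\<parallel>T f\<parallel>\<^sup>2 - 2 Re \<langle>K x, f\<rangle>\<close>.  Conversely, for \<open>\<parallel>T f\<parallel> \<le> 1\<close> the functionals \<open>x \<mapsto> \<langle>K x, f\<rangle>\<close> are
  pointwise bounded since \<open>K x\<close> lies in the range of \<open>L\<close>, and the uniform boundedness principle
  gives the lower bound.  The condition on orthonormal bases determines \<open>L\<close>: every unit vector
  supported in one coordinate belongs to some orthonormal basis.
\<close>

subsection \<open>Scalars\<close>

lemma conjg_mult_self: "conjg x * x = of_real ((norm x)\<^sup>2)" for x :: "'k::real_or_complex"
  using mult_conjg[of x] by (simp add: mult.commute of_real_def)

text \<open>In a field the axiom \<open>mult_conjg\<close> determines \<open>conjg\<close>, so
  multiplicativity, isometry and the fixing of reals follow by computing with this quotient.\<close>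

lemma conjg_eq: "x \<noteq> 0 \<Longrightarrow> conjg x = of_real ((norm x)\<^sup>2) / x" for x :: "'k::real_or_complex"
  using conjg_mult_self[of x] by (simp add: field_simps)

lemma conjg_0 [simp]: "conjg (0::'k::real_or_complex) = 0"
  using conjg_add[of 0 "0::'k"] by simp

lemma conjg_mult: "conjg (x * y) = conjg x * conjg y" for x y :: "'k::real_or_complex"
  by (cases "x = 0 \<or> y = 0") (auto simp: conjg_eq norm_mult power_mult_distrib)

lemma conjg_of_real [simp]: "conjg (of_real r) = (of_real r :: 'k::real_or_complex)"
  by (cases "r = 0") (auto simp: conjg_eq power2_eq_square)

lemma norm_conjg [simp]: "norm (conjg x) = norm x" for x :: "'k::real_or_complex"
  by (cases "x = 0") (auto simp: conjg_eq norm_divide norm_power power2_eq_square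
      simp del: of_real_power of_real_mult)

lemma conjg_conjg [simp]: "conjg (conjg x) = x" for x :: "'k::real_or_complex"
proof (cases "x = 0")
  case False
  then have "conjg x \<noteq> 0" by (metis norm_conjg norm_eq_zero)
  then have "conjg (conjg x) * conjg x = x * conjg x"
    using conjg_mult_self[of "conjg x"] conjg_mult_self[of x] by (simp add: mult.commute)
  then show ?thesis using \<open>conjg x \<noteq> 0\<close> by simp
qed simp

text \<open>The class has no real part; polarisation recovers it from the norm.\<close>

definition re_part :: "'k::real_or_complex \<Rightarrow> real" where
  "re_part x = ((norm (x + 1))\<^sup>2 - (norm x)\<^sup>2 - 1) / 2"

lemma of_real_re_part: "of_real (2 * re_part x) = x + conjg x" for x :: "'k::real_or_complex"
proof -
  have "conjg 1 = (1::'k)" using conjg_of_real[of 1] by simp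
  then have "of_real ((norm (x + 1))\<^sup>2) = conjg x * x + conjg x + x + 1"
    by (simp only: conjg_mult_self[symmetric] conjg_add) (simp add: algebra_simps)
  also have "conjg x * x = of_real ((norm x)\<^sup>2)" by (rule conjg_mult_self)
  finally show ?thesis by (simp add: re_part_def)
qed

text \<open>Injectivity of \<open>of_real\<close> lets identities for \<open>re_part\<close> be
  checked in the scalar field, where \<open>x + conjg x\<close> is additive and commutes with real
  factors.\<close>

lemma re_part_unique: "of_real (2 * r) = x + conjg x \<Longrightarrow> re_part x = r" for x :: "'k::real_or_complex"
  using of_real_re_part[of x] by (metis mult_cancel_left of_real_eq_iff zero_neq_numeral)

lemma re_part_add: "re_part (x + y) = re_part x + re_part y" for x y :: "'k::real_or_complex"
proof (rule re_part_unique)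
  have "of_real (2 * (re_part x + re_part y)) = (of_real (2 * re_part x) + of_real (2 * re_part y) :: 'k)"
    by (simp add: algebra_simps)
  then show "of_real (2 * (re_part x + re_part y)) = x + y + conjg (x + y)"
    by (simp add: of_real_re_part conjg_add del: of_real_mult)
qed

lemma re_part_of_real_mult: "re_part (of_real r * x) = r * re_part x" for x :: "'k::real_or_complex"
proof (rule re_part_unique)
  have "of_real (2 * (r * re_part x)) = (of_real r * of_real (2 * re_part x) :: 'k)"
    by (simp add: algebra_simps)
  then show "of_real (2 * (r * re_part x)) = of_real r * x + conjg (of_real r * x)"
    unfolding of_real_re_part by (simp add: conjg_mult algebra_simps)
qed

lemma re_part_of_real [simp]: "re_part (of_real r :: 'k::real_or_complex) = r"
  by (rule re_part_unique) simp

lemma re_part_conjg [simp]: "re_part (conjg x) = re_part x" for x :: "'k::real_or_complex"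
  by (rule re_part_unique) (simp add: of_real_re_part add.commute del: of_real_mult)

subsection \<open>Positive semidefinite forms\<close>

lemma nonneg_quadratic_discriminant:
  fixes a b c :: real
  assumes "\<And>t. 0 \<le> c + 2 * t * b + t\<^sup>2 * a" and "0 \<le> a"
  shows "b\<^sup>2 \<le> a * c"
proof (cases "a = 0")
  case True
  have "b = 0"
  proof (rule ccontr)
    assume "b \<noteq> 0"
    \<comment> \<open>The affine function \<open>c + 2 * t * b\<close> takes the value -1 at this
      \<open>t\<close>.\<close>
    then show False using assms(1)[of "- (c + 1) / (2 * b)"] True by (simp add: field_simps)
  qed
  then show ?thesis using True by simp
next
  case False
  then have "a > 0" using assms(2) by simp
  \<comment> \<open>The quadratic is evaluated at its minimiser \<open>t = - b / a\<close>.\<close>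
  have "0 \<le> c + 2 * (- b / a) * b + (- b / a)\<^sup>2 * a" by (rule assms(1))
  also have "\<dots> = c - b\<^sup>2 / a" using \<open>a > 0\<close> by (simp add: field_simps power2_eq_square)
  finally show ?thesis using \<open>a > 0\<close> by (simp add: field_simps)
qed

lemma psd_bilinear_Cauchy_Schwarz:
  fixes Q :: "'a::real_vector \<Rightarrow> 'a \<Rightarrow> real"
  assumes "bilinear Q" "\<And>x y. Q x y = Q y x" "\<And>x. 0 \<le> Q x x"
  shows "(Q x y)\<^sup>2 \<le> Q x x * Q y y"
proof -
  have "Q (x + t *\<^sub>R y) (x + t *\<^sub>R y) = Q x x + 2 * t * Q x y + t\<^sup>2 * Q y y" for t
    using assms(2)[of y x]
    by (simp add: bilinear_ladd[OF assms(1)] bilinear_radd[OF assms(1)] bilinear_lmul[OF assms(1)]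
        bilinear_rmul[OF assms(1)] algebra_simps power2_eq_square)
  then have "(Q x y)\<^sup>2 \<le> Q y y * Q x x"
    by (intro nonneg_quadratic_discriminant) (metis assms(3))+
  then show ?thesis by (simp add: mult.commute)
qed

text \<open>A minimising sequence of \<open>f \<mapsto> Q f f - 2 \<phi> f\<close> on \<open>V\<close> is \<open>Q\<close>-Cauchy by the parallelogram law.\<close>

lemma psd_bilinear_Riesz_sequence:
  fixes Q :: "'a::real_vector \<Rightarrow> 'a \<Rightarrow> real" and \<phi> :: "'a \<Rightarrow> real"
  assumes Q: "bilinear Q" and sym: "\<And>x y. Q x y = Q y x" and pos: "\<And>x. 0 \<le> Q x x"
    and \<phi>: "linear \<phi>" and bound: "\<And>x. (\<phi> x)\<^sup>2 \<le> C * Q x x" and C: "0 \<le> C" and V: "subspace V"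
  obtains f :: "nat \<Rightarrow> 'a" where "\<And>n. f n \<in> V"
    and "\<And>e. 0 < e \<Longrightarrow> \<exists>M. \<forall>m\<ge>M. \<forall>n\<ge>M. Q (f m - f n) (f m - f n) < e"
    and "\<And>h. h \<in> V \<Longrightarrow> (\<lambda>n. Q (f n) h) \<longlonglongrightarrow> \<phi> h"
proof -
  note Q_simps = bilinear_ladd[OF Q] bilinear_radd[OF Q] bilinear_lmul[OF Q] bilinear_rmul[OF Q]
    bilinear_lsub[OF Q] bilinear_rsub[OF Q] linear_add[OF \<phi>] linear_cmul[OF \<phi>] linear_diff[OF \<phi>]
  define J where "J f = Q f f - 2 * \<phi> f" for f
  have J_ge: "- C \<le> J f" for f
  proof (cases "C = 0")
    case False
    \<comment> \<open>Completing the square: with \<open>bound\<close> this gives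
      \<open>2 * C * \<phi> f \<le> C * (Q f f + C)\<close>, from which \<open>C > 0\<close> is
      cancelled. For \<open>C = 0\<close> the bound forces \<open>\<phi> f = 0\<close>.\<close>
    have "0 \<le> (\<phi> f - C)\<^sup>2" by simp
    then have "2 * C * \<phi> f \<le> C * Q f f + C * C"
      using bound[of f] by (simp add: power2_eq_square algebra_simps)
    then have "C * (2 * \<phi> f) \<le> C * (Q f f + C)" by (simp add: algebra_simps)
    then show ?thesis using False C by (simp add: J_def)
  qed (use bound[of f] pos[of f] in \<open>simp add: J_def\<close>)
  define \<mu> where "\<mu> = Inf (J ` V)"
  have bdd: "bdd_below (J ` V)" using J_ge by (intro bdd_belowI[of _ "- C"]) auto
  have mu_le: "\<mu> \<le> J f" if "f \<in> V" for f
    using that bdd by (simp add: \<mu>_def cInf_lower)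
  have "0 \<in> V" using V by (rule subspace_0)
  have "\<exists>f\<in>V. J f < \<mu> + 1 / real (Suc n)" for n
  proof -
    have "\<exists>y\<in>J ` V. y < \<mu> + 1 / real (Suc n)"
      using \<open>0 \<in> V\<close> by (intro cInf_lessD) (auto simp: \<mu>_def)
    then show ?thesis by blast
  qed
  then obtain f where fV: "\<And>n. f n \<in> V" and fJ: "\<And>n. J (f n) < \<mu> + 1 / real (Suc n)"
    by metis
  \<comment> \<open>The linear terms cancel, so near-minimality of \<open>J x\<close> and
    \<open>J y\<close>, together with \<open>\<mu> \<le> J\<close> at the midpoint, makes
    \<open>Q (x - y) (x - y)\<close> small.\<close>
  have parallelogram: "Q (x - y) (x - y) = 2 * J x + 2 * J y - 4 * J ((1/2) *\<^sub>R (x + y))" for x y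
    using sym[of x y] by (simp add: J_def Q_simps algebra_simps)
  show ?thesis
  proof
    show "f n \<in> V" for n by (rule fV)
    show "\<exists>M. \<forall>m\<ge>M. \<forall>n\<ge>M. Q (f m - f n) (f m - f n) < e" if "0 < e" for e
    proof -
      \<comment> \<open>The errors of \<open>f m\<close> and \<open>f n\<close> enter with a factor
        2 each, hence \<open>e / 4\<close>.\<close>
      obtain M where M: "1 / real (Suc M) < e / 4"
        using \<open>0 < e\<close> by (metis nat_approx_posE zero_less_divide_iff zero_less_numeral)
      have "Q (f m - f n) (f m - f n) < e" if "m \<ge> M" "n \<ge> M" for m n
      proof -
        have "1 / real (Suc m) \<le> 1 / real (Suc M)" "1 / real (Suc n) \<le> 1 / real (Suc M)"
          using that by (auto intro!: divide_left_mono)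
        moreover have "\<mu> \<le> J ((1/2) *\<^sub>R (f m + f n))"
          by (intro mu_le subspace_scale[OF V] subspace_add[OF V] fV)
        ultimately show ?thesis
          unfolding parallelogram using M fJ[of m] fJ[of n] by linarith
      qed
      then show ?thesis by blast
    qed
    show "(\<lambda>n. Q (f n) h) \<longlonglongrightarrow> \<phi> h" if "h \<in> V" for h
    proof -
      \<comment> \<open>First variation: moving from \<open>f n\<close> along \<open>h\<close>
        lowers \<open>J\<close> by less than \<open>1 / (n + 1)\<close>, so a quadratic in
        \<open>t\<close> is nonnegative and its discriminant is bounded.\<close>
      have variation: "(Q (f n) h - \<phi> h)\<^sup>2 \<le> Q h h * (1 / real (Suc n))" for n
      proof (rule nonneg_quadratic_discriminant)
        fix t :: real
        have "J (f n + t *\<^sub>R h) = J (f n) + 2 * t * (Q (f n) h - \<phi> h) + t\<^sup>2 * Q h h"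
          using sym[of h "f n"] by (simp add: J_def Q_simps algebra_simps power2_eq_square)
        moreover have "\<mu> \<le> J (f n + t *\<^sub>R h)"
          by (intro mu_le subspace_add[OF V] subspace_scale[OF V] fV that)
        ultimately show "0 \<le> 1 / real (Suc n) + 2 * t * (Q (f n) h - \<phi> h) + t\<^sup>2 * Q h h"
          using fJ[of n] by linarith
      qed (rule pos)
      have "(\<lambda>n. Q h h * (1 / real (Suc n))) \<longlonglongrightarrow> Q h h * 0"
        by (intro tendsto_mult tendsto_const) (rule LIMSEQ_inverse_real_of_nat[unfolded inverse_eq_divide])
      then have "(\<lambda>n. Q h h * (1 / real (Suc n))) \<longlonglongrightarrow> 0"
        by simp
      then have "(\<lambda>n. (Q (f n) h - \<phi> h)\<^sup>2) \<longlonglongrightarrow> 0"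
        by (rule tendsto_sandwich[OF always_eventually always_eventually tendsto_const, rotated 2])
          (simp_all only: variation zero_le_power2 simp_thms)
      then have "(\<lambda>n. sqrt ((Q (f n) h - \<phi> h)\<^sup>2)) \<longlonglongrightarrow> sqrt 0"
        by (rule tendsto_real_sqrt)
      then have "(\<lambda>n. Q (f n) h - \<phi> h) \<longlonglongrightarrow> 0"
        by (simp add: tendsto_rabs_zero_iff)
      then show ?thesis by (simp add: LIM_zero_iff)
    qed
  qed
qed

subsection \<open>Projections and adjoints\<close>

context hilbert_space
begin

definition rip :: "'h \<Rightarrow> 'h \<Rightarrow> real" where "rip x y = re_part (ip x y)"

lemma ip_add_right: "ip z (x + y) = ip z x + ip z y"
  by (metis ip_commute ip_add_left conjg_add)

lemma ip_smul_right: "ip x (smul a y) = conjg a * ip x y"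
  by (metis ip_commute ip_smul_left conjg_mult)

lemma ip_zero_left [simp]: "ip 0 y = 0"
  using ip_add_left[of 0 0 y] by simp

lemma ip_zero_right [simp]: "ip x 0 = 0"
  using ip_add_right[of x 0 0] by simp

lemma ip_minus_left: "ip (- x) y = - ip x y"
  using ip_add_left[of x "- x" y] by (simp add: eq_neg_iff_add_eq_0 add.commute)

lemma ip_minus_right: "ip x (- y) = - ip x y"
  using ip_add_right[of x y "- y"] by (simp add: eq_neg_iff_add_eq_0 add.commute)

lemma ip_diff_left: "ip (x - y) z = ip x z - ip y z"
  using ip_add_left[of x "- y" z] by (simp add: ip_minus_left)

lemma ip_diff_right: "ip z (x - y) = ip z x - ip z y"
  using ip_add_right[of z x "- y"] by (simp add: ip_minus_right)

lemma ip_sum_left: "ip (\<Sum>i\<in>A. f i) z = (\<Sum>i\<in>A. ip (f i) z)"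
  by (induction A rule: infinite_finite_induct) (simp_all add: ip_add_left)

section \<open>The real part of the inner product as a bounded symmetric bilinear form\<close>

lemma rip_add_left: "rip (x + y) z = rip x z + rip y z"
  by (simp add: rip_def ip_add_left re_part_add)

lemma rip_commute: "rip x y = rip y x"
  by (metis rip_def ip_commute re_part_conjg)

lemma rip_scaleR_left: "rip (r *\<^sub>R x) y = r * rip x y"
  by (simp add: rip_def smul_of_real[symmetric] ip_smul_left re_part_of_real_mult)

lemma rip_self: "rip x x = (norm x)\<^sup>2"
  by (simp only: rip_def ip_self re_part_of_real)

lemma bilinear_rip: "bilinear rip"
proof -
  have 1: "linear (\<lambda>x. rip x y)" for y
    by (rule linearI) (simp_all add: rip_add_left rip_scaleR_left)
  have 2: "linear (rip x)" for x
    using 1[of x] by (subst (asm) rip_commute) 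
  show ?thesis using 1 2 by (simp add: bilinear_def)
qed

lemma rip_Cauchy_Schwarz: "\<bar>rip x y\<bar> \<le> norm x * norm y"
proof -
  have "(rip x y)\<^sup>2 \<le> rip x x * rip y y"
    by (intro psd_bilinear_Cauchy_Schwarz bilinear_rip rip_commute) (simp add: rip_self)
  then have "\<bar>rip x y\<bar>\<^sup>2 \<le> (norm x * norm y)\<^sup>2"
    by (simp add: rip_self power_mult_distrib)
  then show ?thesis by (rule power2_le_imp_le) simp
qed

lemma bounded_bilinear_rip: "bounded_bilinear rip"
proof
  show "\<exists>K. \<forall>a b. norm (rip a b) \<le> norm a * norm b * K"
    using rip_Cauchy_Schwarz by (intro exI[of _ 1]) simp
qed (simp_all add: bilinear_ladd bilinear_radd bilinear_lmul bilinear_rmul bilinear_rip)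

lemmas rip_simps = bilinear_ladd[OF bilinear_rip] bilinear_radd[OF bilinear_rip]
  bilinear_lmul[OF bilinear_rip] bilinear_rmul[OF bilinear_rip]
  bilinear_lsub[OF bilinear_rip] bilinear_rsub[OF bilinear_rip]

lemmas bounded_linear_rip_left = bounded_bilinear.bounded_linear_left[OF bounded_bilinear_rip]

text \<open>The choice \<open>a = conjg (ip x y)\<close> turns the real part into the squared
  modulus of \<open>ip x y\<close>. This lifts orthogonality from \<open>rip\<close> to
  \<open>ip\<close>.\<close>

lemma ip_eq_zero_if_rip:
  assumes "\<And>a. rip (smul a x) y = 0"
  shows "ip x y = 0"
proof -
  have "re_part (conjg (ip x y) * ip x y) = 0"
    using assms[of "conjg (ip x y)"] by (simp add: rip_def ip_smul_left)
  then have "(norm (ip x y))\<^sup>2 = 0"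
    by (simp only: conjg_mult_self re_part_of_real)
  then show ?thesis by simp
qed

text \<open>Homogeneity for general scalars comes from the inner product: \<open>ip_self\<close>
  expresses the norm of \<open>smul a x\<close>, and the scalar is pulled out of both
  arguments.\<close>

lemma norm_smul: "norm (smul a x) = norm a * norm x"
proof -
  have "of_real ((norm (smul a x))\<^sup>2) = (of_real ((norm a * norm x)\<^sup>2) :: 'k)"
    unfolding ip_self[symmetric] ip_smul_left ip_smul_right
    by (simp add: ip_self power_mult_distrib conjg_mult_self[of a, simplified]
       mult.assoc[symmetric] mult.commute[of a])
  then have "(norm (smul a x))\<^sup>2 = (norm a * norm x)\<^sup>2"
    by (simp only: of_real_eq_iff)
  then show ?thesis by (rule power2_eq_imp_eq) simp_all
qed

lemma smul_scaleR_commute: "smul a (r *\<^sub>R x) = r *\<^sub>R smul a x"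
  by (simp add: smul_of_real[symmetric] mult.commute)

lemma bounded_linear_smul: "bounded_linear (smul a)"
  by (rule bounded_linear_intro[of _ "norm a"])
    (simp_all add: scale_right_distrib smul_scaleR_commute norm_smul mult.commute)

lemma real_subspace: "subspace V \<Longrightarrow> Real_Vector_Spaces.subspace V"
  using subspace_0[of V] subspace_add[of V] subspace_scale[of V]
  by (auto simp: real_vector.subspace_def smul_of_real[symmetric])

text \<open>The Riesz sequence for \<open>rip\<close> and the functional \<open>rip x\<close> on
  \<open>V\<close> is Cauchy in norm; its limit lies in the closed set \<open>V\<close> and has the
  same real products with \<open>V\<close> as \<open>x\<close>. Closure of \<open>V\<close> under
  all scalars turns this into orthogonality for \<open>ip\<close>.\<close>

lemma ex_orth_proj:
  assumes "closed_subspace smul V"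
  shows "\<exists>p\<in>V. \<forall>w\<in>V. ip (x - p) w = 0"
proof -
  have V: "subspace V" and "closed V" using assms by (auto simp: closed_subspace_def)
  obtain f where f: "\<And>n. f n \<in> V"
    and cauchy: "\<And>e. 0 < e \<Longrightarrow> \<exists>M. \<forall>m\<ge>M. \<forall>n\<ge>M. rip (f m - f n) (f m - f n) < e"
    and lim: "\<And>h. h \<in> V \<Longrightarrow> (\<lambda>n. rip (f n) h) \<longlonglongrightarrow> rip x h"
  proof (rule psd_bilinear_Riesz_sequence[of rip "rip x" "(norm x)\<^sup>2" V])
    show "(rip x y)\<^sup>2 \<le> (norm x)\<^sup>2 * rip y y" for y
      using psd_bilinear_Cauchy_Schwarz[OF bilinear_rip rip_commute, of x y] by (simp add: rip_self)
    show "linear (rip x)" using bilinear_rip by (simp add: bilinear_def)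
  qed (use V in \<open>auto simp: bilinear_rip rip_self real_subspace rip_commute[symmetric]\<close>)
  have "Cauchy f"
  proof (rule CauchyI)
    fix e :: real assume "0 < e"
    then obtain M where "\<forall>m\<ge>M. \<forall>n\<ge>M. (norm (f m - f n))\<^sup>2 < e\<^sup>2"
      using cauchy[of "e\<^sup>2"] by (auto simp: rip_self)
    then show "\<exists>M. \<forall>m\<ge>M. \<forall>n\<ge>M. norm (f m - f n) < e"
      using \<open>0 < e\<close> by (meson less_imp_le power2_less_imp_less)
  qed
  then obtain p where p: "f \<longlonglongrightarrow> p" using Cauchy_convergent convergent_def by blast
  have "p \<in> V" using closed_sequentially[OF \<open>closed V\<close> f p] .
  have rip_eq: "rip p h = rip x h" if "h \<in> V" for h
    by (rule LIMSEQ_unique[OF bounded_linear.tendsto[OF bounded_linear_rip_left p] lim[OF that]])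
  have "ip w (x - p) = 0" if "w \<in> V" for w
  proof (rule ip_eq_zero_if_rip)
    fix a show "rip (smul a w) (x - p) = 0"
      using rip_eq[of "smul a w"] subspace_scale[OF V that]
      by (simp add: rip_simps rip_commute[of "smul a w"])
  qed
  then have "\<forall>w\<in>V. ip (x - p) w = 0" by (metis ip_commute conjg_0)
  then show ?thesis using \<open>p \<in> V\<close> by blast
qed

text \<open>The description defining \<open>orth_proj\<close> is proper: the difference of two
  candidates lies in \<open>V\<close> and is orthogonal to itself.\<close>

lemma orth_proj:
  assumes "closed_subspace smul V"
  shows orth_proj_mem: "orth_proj ip V x \<in> V"
    and ip_orth_proj: "w \<in> V \<Longrightarrow> ip (orth_proj ip V x) w = ip x w"
proof -
  have V: "subspace V" using assms by (auto simp: closed_subspace_def)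
  have unique: "p = q" if "p \<in> V" "\<forall>w\<in>V. ip (x - p) w = 0" "q \<in> V" "\<forall>w\<in>V. ip (x - q) w = 0" for p q
  proof -
    have "ip (p - q) (p - q) = ip (x - q) (p - q) - ip (x - p) (p - q)"
      by (simp add: ip_diff_left)
    also have "\<dots> = 0" using that subspace_diff[OF V, of p q] by simp
    finally show ?thesis by (simp add: ip_self)
  qed
  obtain p where p: "p \<in> V" "\<forall>w\<in>V. ip (x - p) w = 0"
    using ex_orth_proj[OF assms] by blast
  have "orth_proj ip V x \<in> V \<and> (\<forall>w\<in>V. ip (x - orth_proj ip V x) w = 0)"
    unfolding orth_proj_def by (rule theI[of _ p]) (use p unique in blast)+
  then show "orth_proj ip V x \<in> V" "w \<in> V \<Longrightarrow> ip (orth_proj ip V x) w = ip x w"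
    by (auto simp: ip_diff_left)
qed

lemma rip_orth_proj:
  assumes "closed_subspace smul V" "w \<in> V"
  shows "rip (orth_proj ip V x) w = rip x w"
  using assms by (simp add: rip_def ip_orth_proj)

text \<open>The difference of the two candidates lies in \<open>V\<close>, so testing with it in the
  real form shows that its norm is 0. Linearity of the projection is derived from this
  criterion.\<close>

lemma orth_proj_unique:
  assumes "closed_subspace smul V" "p \<in> V" "\<And>w. w \<in> V \<Longrightarrow> rip p w = rip x w"
  shows "orth_proj ip V x = p"
proof -
  let ?d = "orth_proj ip V x - p"
  have V: "subspace V" using assms by (auto simp: closed_subspace_def)
  then have "?d \<in> V" using orth_proj_mem[OF assms(1)] assms(2) by (rule subspace_diff)
  then have "rip ?d ?d = 0"
    using assms(3)[of ?d] rip_orth_proj[OF assms(1), of ?d x] by (simp add: bilinear_lsub[OF bilinear_rip])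
  then show ?thesis by (simp add: rip_self)
qed

lemma linear_orth_proj:
  assumes "closed_subspace smul V"
  shows "linear (orth_proj ip V)"
proof -
  have V: "Real_Vector_Spaces.subspace V" using assms by (auto simp: closed_subspace_def real_subspace)
  note mem = orth_proj_mem[OF assms]
  show ?thesis
    by (rule linearI; rule orth_proj_unique[OF assms])
      (auto intro: real_vector.subspace_add[OF V] real_vector.subspace_scale[OF V] mem
        simp: rip_simps rip_orth_proj[OF assms])
qed

lemma rip_orth_proj_right:
  assumes "closed_subspace smul V" "w \<in> V"
  shows "rip w (orth_proj ip V x) = rip w x"
  using rip_orth_proj[OF assms] by (simp add: rip_commute[of w])

lemma norm_orth_proj_le:
  assumes "closed_subspace smul V"
  shows "norm (orth_proj ip V x) \<le> norm x"
proof -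
  let ?p = "orth_proj ip V x"
  have "norm ?p * norm ?p = rip x ?p"
    using rip_orth_proj[OF assms orth_proj_mem[OF assms], of x x] by (simp add: rip_self power2_eq_square)
  also have "\<dots> \<le> norm x * norm ?p" using rip_Cauchy_Schwarz[of x ?p] by simp
  finally show ?thesis by (cases "?p = 0") auto
qed

lemma orth_proj_ident:
  assumes "closed_subspace smul V" "w \<in> V"
  shows "orth_proj ip V w = w"
  using assms by (intro orth_proj_unique) auto

text \<open>Riesz representation: the sequence for \<open>rip\<close> on the whole space and the
  functional \<open>h \<mapsto> rip (K h) y\<close> converges to the representing vector. The
  constant \<open>(c * norm y)^2\<close> comes from boundedness of \<open>K\<close> and
  Cauchy-Schwarz.\<close>

lemma ex_adjoint:
  assumes "bounded_op smul K"
  shows "\<exists>z. \<forall>x. ip (K x) y = ip x z"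
proof -
  have "bounded_linear K" and K_smul: "\<And>a x. K (smul a x) = smul a (K x)"
    using assms by (auto simp: bounded_op_def)
  interpret K: bounded_linear K by fact
  obtain c where c: "0 < c" "\<And>x. norm (K x) \<le> norm x * c" using K.pos_bounded by blast
  obtain f where 
    cauchy: "\<And>e. 0 < e \<Longrightarrow> \<exists>M. \<forall>m\<ge>M. \<forall>n\<ge>M. rip (f m - f n) (f m - f n) < e"
    and lim: "\<And>h. (\<lambda>n. rip (f n) h) \<longlonglongrightarrow> rip (K h) y"
  proof (rule psd_bilinear_Riesz_sequence[of rip "\<lambda>h. rip (K h) y" "(c * norm y)\<^sup>2" UNIV])
    show "(rip (K x) y)\<^sup>2 \<le> (c * norm y)\<^sup>2 * rip x x" for x
    proof -
      have "\<bar>rip (K x) y\<bar> \<le> norm (K x) * norm y" by (rule rip_Cauchy_Schwarz)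
      also have "\<dots> \<le> (norm x * c) * norm y" using c by (intro mult_right_mono) auto
      finally have "\<bar>rip (K x) y\<bar>\<^sup>2 \<le> ((norm x * c) * norm y)\<^sup>2" by (intro power_mono) auto
      then show ?thesis by (simp add: rip_self power_mult_distrib mult_ac)
    qed
    show "linear (\<lambda>h. rip (K h) y)"
      by (rule linearI) (simp_all add: K.add K.scaleR rip_simps)
  qed (auto simp: bilinear_rip rip_self rip_commute[symmetric])
  have "Cauchy f"
  proof (rule CauchyI)
    fix e :: real assume "0 < e"
    then obtain M where "\<forall>m\<ge>M. \<forall>n\<ge>M. (norm (f m - f n))\<^sup>2 < e\<^sup>2"
      using cauchy[of "e\<^sup>2"] by (auto simp: rip_self)
    then show "\<exists>M. \<forall>m\<ge>M. \<forall>n\<ge>M. norm (f m - f n) < e"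
      using \<open>0 < e\<close> by (meson less_imp_le power2_less_imp_less)
  qed
  then obtain z where z: "f \<longlonglongrightarrow> z" using Cauchy_convergent convergent_def by blast
  have rip_eq: "rip z h = rip (K h) y" for h
    by (rule LIMSEQ_unique[OF bounded_linear.tendsto[OF bounded_linear_rip_left z] lim])
  have "ip (K x) y = ip x z" for x
  proof -
    \<comment> \<open>Testing the real identity at \<open>smul (conjg ?d) x\<close> gives
      \<open>re_part (conjg ?d * ?d) = 0\<close>, which forces \<open>?d = 0\<close>.\<close>
    let ?d = "ip (K x) y - ip x z"
    have "re_part (conjg ?d * ip (K x) y) = re_part (conjg ?d * ip x z)"
      using rip_eq[of "smul (conjg ?d) x"] rip_commute[of z] by (simp add: rip_def K_smul ip_smul_left)
    moreover have "conjg ?d * ip (K x) y = conjg ?d * ip x z + conjg ?d * ?d" by (simp add: algebra_simps)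
    ultimately have "re_part (conjg ?d * ?d) = 0" by (simp add: re_part_add)
    then have "(norm ?d)\<^sup>2 = 0" by (simp only: conjg_mult_self re_part_of_real)
    then show ?thesis by simp
  qed
  then show ?thesis by blast
qed

lemma rip_adjoint_op:
  assumes "bounded_op smul K"
  shows "rip (K x) y = rip x (adjoint_op ip K y)"
proof -
  obtain S where S: "\<And>x y. ip (K x) y = ip x (S y)" using ex_adjoint[OF assms] by metis
  have unique: "S' = S" if "\<forall>x y. ip (K x) y = ip x (S' y)" for S'
  proof
    fix y
    have "ip (S' y - S y) (S' y - S y) = 0"
      using that S by (simp add: ip_diff_right)
    then show "S' y = S y" by (simp add: ip_self)
  qed
  have "\<forall>x y. ip (K x) y = ip x (adjoint_op ip K y)"
    unfolding adjoint_op_def by (rule theI[of _ S]) (simp_all only: S unique simp_thms)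
  then show ?thesis by (simp add: rip_def)
qed

end

subsection \<open>Square-summable families\<close>

lemma infsum_tail_less:
  fixes a :: "'i \<Rightarrow> real"
  assumes "a summable_on I" "0 < e"
  obtains F where "finite F" "F \<subseteq> I" "infsum a (I - F) < e"
proof -
  obtain F where F: "finite F" "F \<subseteq> I" "dist (sum a F) (infsum a I) \<le> e / 2"
    using infsum_finite_approximation[OF assms(1), of "e / 2"] assms(2) by auto
  have "infsum a (I - F) = infsum a I - infsum a F"
    by (rule infsum_Diff) (use assms F in auto)
  then have "infsum a (I - F) < e" using F assms(2) by (auto simp: dist_real_def abs_if split: if_splits)
  then show thesis using that F by blast
qed

text \<open>Cauchy criterion for the net of finite partial sums: beyond a finite set carrying almost
  all of \<open>a\<close>, the partial sums of \<open>f\<close> change little. It yields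
  unconditional convergence where absolute convergence may fail.\<close>

lemma summable_on_norm_sum_le:
  fixes f :: "'i \<Rightarrow> 'h::banach" and a :: "'i \<Rightarrow> real"
  assumes a: "a summable_on I" "\<And>i. i \<in> I \<Longrightarrow> 0 \<le> a i" and "0 \<le> C"
    and bound: "\<And>F. finite F \<Longrightarrow> F \<subseteq> I \<Longrightarrow> (norm (sum f F))\<^sup>2 \<le> C * sum a F"
  shows "f summable_on I"
proof -
  have "\<exists>P. eventually P (finite_subsets_at_top I) \<and>
          (\<forall>F F'. P F \<and> P F' \<longrightarrow> dist (sum f F) (sum f F') < e)" if "0 < e" for e
  proof -
    \<comment> \<open>\<open>C + 1\<close> in place of \<open>C\<close> keeps the quotient positive
      for \<open>C = 0\<close>.\<close>
    have "0 < (e / 2)\<^sup>2 / (C + 1)" using that \<open>0 \<le> C\<close> by simp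
    then obtain F0 where F0: "finite F0" "F0 \<subseteq> I" "infsum a (I - F0) < (e / 2)\<^sup>2 / (C + 1)"
      using infsum_tail_less[OF a(1)] by metis
    have near: "dist (sum f F) (sum f F0) < e / 2" if F: "finite F" "F0 \<subseteq> F" "F \<subseteq> I" for F
    proof -
      have "sum a (F - F0) \<le> infsum a (I - F0)"
        using F a by (intro finite_sum_le_infsum summable_on_subset_banach[OF a(1)]) auto
      then have tail: "sum a (F - F0) < (e / 2)\<^sup>2 / (C + 1)" using F0 by simp
      have "0 \<le> sum a (F - F0)" using a F by (intro sum_nonneg) auto
      have "(norm (sum f (F - F0)))\<^sup>2 \<le> C * sum a (F - F0)" using F by (intro bound) auto
      also have "\<dots> \<le> (C + 1) * sum a (F - F0)" using \<open>0 \<le> sum a (F - F0)\<close> by (simp add: algebra_simps)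
      also have "\<dots> < (C + 1) * ((e / 2)\<^sup>2 / (C + 1))"
        using tail \<open>0 \<le> C\<close> by (intro mult_strict_left_mono) auto
      also have "\<dots> = (e / 2)\<^sup>2" using \<open>0 \<le> C\<close> by simp
      finally have "norm (sum f (F - F0)) < e / 2"
        using \<open>0 < e\<close> by (intro power2_less_imp_less[of _ "e / 2"]) auto
      then show ?thesis using F by (simp add: sum_diff dist_norm)
    qed
    let ?P = "\<lambda>F. finite F \<and> F0 \<subseteq> F \<and> F \<subseteq> I"
    have "eventually ?P (finite_subsets_at_top I)"
      using F0 by (auto simp: eventually_finite_subsets_at_top)
    moreover have "dist (sum f F) (sum f F') < e" if "?P F \<and> ?P F'" for F F'
      using near[of F] near[of F'] that dist_triangle2[of "sum f F" "sum f F'" "sum f F0"] by linarith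
    ultimately show ?thesis by blast
  qed
  then have "cauchy_filter (filtermap (sum f) (finite_subsets_at_top I))"
    by (simp add: cauchy_filter_metric_filtermap)
  moreover have "complete (UNIV :: 'h set)"
    by (meson Cauchy_convergent UNIV_I complete_def convergent_def)
  ultimately obtain s where "(sum f \<longlongrightarrow> s) (finite_subsets_at_top I)"
    using complete_uniform[where S=UNIV] by (force simp add: filterlim_def)
  then show ?thesis by (auto simp: summable_on_def has_sum_def)
qed

section \<open>Norm and completeness of the direct sum\<close>

lemma l2_norm_nonneg [simp]: "0 \<le> l2_norm I f"
  by (simp add: l2_norm_def infsum_nonneg)

lemma l2_norm_power2: "(l2_norm I f)\<^sup>2 = (\<Sum>\<^sub>\<infinity>i\<in>I. (norm (f i))\<^sup>2)"
  by (simp add: l2_norm_def infsum_nonneg)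

lemma sum_norm_le_l2_norm:
  assumes "(\<lambda>i. (norm (f i))\<^sup>2) summable_on I" "finite F" "F \<subseteq> I"
  shows "(\<Sum>i\<in>F. (norm (f i))\<^sup>2) \<le> (l2_norm I f)\<^sup>2"
  unfolding l2_norm_power2 by (rule finite_sum_le_infsum) (use assms in auto)

lemma norm_add_power2_le: "(norm (x + y))\<^sup>2 \<le> 2 * (norm x)\<^sup>2 + 2 * (norm y)\<^sup>2"
  for x y :: "'a::real_normed_vector"
proof -
  have "(norm (x + y))\<^sup>2 \<le> (norm x + norm y)\<^sup>2" by (intro power_mono norm_triangle_ineq) simp
  also have "\<dots> \<le> 2 * (norm x)\<^sup>2 + 2 * (norm y)\<^sup>2"
    using zero_le_power2[of "norm x - norm y"] by (simp add: power2_eq_square algebra_simps)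
  finally show ?thesis .
qed

lemma summable_on_norm_add_power2:
  fixes f g :: "'i \<Rightarrow> 'h::real_normed_vector"
  assumes "(\<lambda>i. (norm (f i))\<^sup>2) summable_on I" "(\<lambda>i. (norm (g i))\<^sup>2) summable_on I"
  shows "(\<lambda>i. (norm (f i + g i))\<^sup>2) summable_on I"
proof (rule summable_on_comparison_test)
  show "(\<lambda>i. 2 * (norm (f i))\<^sup>2 + 2 * (norm (g i))\<^sup>2) summable_on I"
    by (intro summable_on_add summable_on_cmult_right assms)
qed (simp_all add: norm_add_power2_le)

lemma summable_on_norm_diff_power2:
  fixes f g :: "'i \<Rightarrow> 'h::real_normed_vector"
  assumes "(\<lambda>i. (norm (f i))\<^sup>2) summable_on I" "(\<lambda>i. (norm (g i))\<^sup>2) summable_on I"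
  shows "(\<lambda>i. (norm (f i - g i))\<^sup>2) summable_on I"
  using summable_on_norm_add_power2[of f I "\<lambda>i. - g i"] assms by simp

text \<open>Limits are taken coordinatewise, and the Cauchy estimate passes to the limit on finite
  index sets with a bound independent of the set.\<close>

lemma l2_sum_complete:
  fixes g :: "nat \<Rightarrow> 'i \<Rightarrow> 'h::banach"
  assumes W: "\<And>i. i \<in> I \<Longrightarrow> closed (W i)" and g: "\<And>n. g n \<in> l2_sum I W"
    and cauchy: "\<And>e. 0 < e \<Longrightarrow> \<exists>M. \<forall>m\<ge>M. \<forall>n\<ge>M. (\<Sum>\<^sub>\<infinity>i\<in>I. (norm (g m i - g n i))\<^sup>2) < e"
  obtains h where "h \<in> l2_sum I W" "(\<lambda>n. \<Sum>\<^sub>\<infinity>i\<in>I. (norm (g n i - h i))\<^sup>2) \<longlonglongrightarrow> 0"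
proof -
  have sq: "(\<lambda>i. (norm (g n i))\<^sup>2) summable_on I" for n using g[of n] by (simp add: l2_sum_def)
  have sqd: "(\<lambda>i. (norm (g m i - g n i))\<^sup>2) summable_on I" for m n
    by (intro summable_on_norm_diff_power2 sq)
  have fin: "(\<Sum>i\<in>F. (norm (g m i - g n i))\<^sup>2) \<le> (\<Sum>\<^sub>\<infinity>i\<in>I. (norm (g m i - g n i))\<^sup>2)"
    if "finite F" "F \<subseteq> I" for F m n
    by (rule finite_sum_le_infsum[OF sqd that]) simp
  have "convergent (\<lambda>n. g n i)" if "i \<in> I" for i
  proof -
    have "Cauchy (\<lambda>n. g n i)"
    proof (rule CauchyI)
      fix e :: real assume "0 < e"
      then obtain M where M: "\<forall>m\<ge>M. \<forall>n\<ge>M. (\<Sum>\<^sub>\<infinity>i\<in>I. (norm (g m i - g n i))\<^sup>2) < e\<^sup>2"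
        using cauchy[of "e\<^sup>2"] by auto
      have "norm (g m i - g n i) < e" if "m \<ge> M" "n \<ge> M" for m n
      proof (rule power2_less_imp_less)
        show "(norm (g m i - g n i))\<^sup>2 < e\<^sup>2"
          using fin[of "{i}" m n] \<open>i \<in> I\<close> M that by fastforce
      qed (use \<open>0 < e\<close> in simp)
      then show "\<exists>M. \<forall>m\<ge>M. \<forall>n\<ge>M. norm (g m i - g n i) < e" by blast
    qed
    then show ?thesis by (rule Cauchy_convergent)
  qed
  then obtain l where l: "\<And>i. i \<in> I \<Longrightarrow> (\<lambda>n. g n i) \<longlonglongrightarrow> l i"
    unfolding convergent_def by metis
  \<comment> \<open>The default 0 outside \<open>I\<close> is what membership in
    \<open>l2_sum I W\<close> demands.\<close>
  define h where "h i = (if i \<in> I then l i else 0)" for i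
  have h: "(\<lambda>n. g n i) \<longlonglongrightarrow> h i" if "i \<in> I" for i using l that by (simp add: h_def)
  have tail: "\<exists>M. \<forall>n\<ge>M. (\<lambda>i. (norm (g n i - h i))\<^sup>2) summable_on I \<and>
      (\<Sum>\<^sub>\<infinity>i\<in>I. (norm (g n i - h i))\<^sup>2) \<le> e" if "0 < e" for e
  proof -
    obtain M where M: "\<forall>m\<ge>M. \<forall>n\<ge>M. (\<Sum>\<^sub>\<infinity>i\<in>I. (norm (g m i - g n i))\<^sup>2) < e"
      using cauchy[OF \<open>0 < e\<close>] by blast
    have "(\<lambda>i. (norm (g n i - h i))\<^sup>2) summable_on I \<and> (\<Sum>\<^sub>\<infinity>i\<in>I. (norm (g n i - h i))\<^sup>2) \<le> e"
      if "n \<ge> M" for n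
    proof -
      \<comment> \<open>On a finite \<open>F\<close> the limit in \<open>m\<close> can be taken
        inside the sum; uniformity in \<open>F\<close> then gives both summability and the bound on
        the full sum.\<close>
      have bound: "(\<Sum>i\<in>F. (norm (g n i - h i))\<^sup>2) \<le> e" if F: "finite F" "F \<subseteq> I" for F
      proof (rule LIMSEQ_le_const2)
        show "(\<lambda>m. \<Sum>i\<in>F. (norm (g n i - g m i))\<^sup>2) \<longlonglongrightarrow> (\<Sum>i\<in>F. (norm (g n i - h i))\<^sup>2)"
          using F by (intro tendsto_intros h) auto
        show "\<exists>N. \<forall>m\<ge>N. (\<Sum>i\<in>F. (norm (g n i - g m i))\<^sup>2) \<le> e"
          using fin[OF F, of n] M \<open>n \<ge> M\<close> by (intro exI[of _ M]) (meson less_imp_le order_trans)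
      qed
      have "(\<lambda>i. (norm (g n i - h i))\<^sup>2) summable_on I"
        by (rule nonneg_bdd_above_summable_on) (auto intro!: bdd_aboveI2[of _ _ e] bound)
      then show ?thesis using bound by (auto intro: infsum_le_finite_sums)
    qed
    then show ?thesis by blast
  qed
  obtain n where n: "(\<lambda>i. (norm (g n i - h i))\<^sup>2) summable_on I"
    using tail[of 1] by auto
  have "h \<in> l2_sum I W"
    unfolding l2_sum_def
  proof (intro CollectI conjI ballI allI impI)
    show "h i \<in> W i" if "i \<in> I" for i
      using closed_sequentially[OF W[OF that] _ h[OF that]] g that by (auto simp: l2_sum_def)
    show "(\<lambda>i. (norm (h i))\<^sup>2) summable_on I"
      using summable_on_norm_diff_power2[OF sq[of n] n] by simp
  qed (simp add: h_def)
  moreover have "(\<lambda>n. \<Sum>\<^sub>\<infinity>i\<in>I. (norm (g n i - h i))\<^sup>2) \<longlonglongrightarrow> 0"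
  proof (rule LIMSEQ_I)
    fix e :: real assume "0 < e"
    then obtain M where "\<forall>n\<ge>M. (\<Sum>\<^sub>\<infinity>i\<in>I. (norm (g n i - h i))\<^sup>2) \<le> e / 2"
      using tail[of "e / 2"] by auto
    then show "\<exists>M. \<forall>n\<ge>M. norm ((\<Sum>\<^sub>\<infinity>i\<in>I. (norm (g n i - h i))\<^sup>2) - 0) < e"
      using \<open>0 < e\<close> by (intro exI[of _ M]) (auto simp: infsum_nonneg)
  qed
  ultimately show thesis by (rule that)
qed

subsection \<open>Analysis and synthesis operators\<close>

locale weighted_subspaces = hilbert_space smul ip
  for smul :: "'k::real_or_complex \<Rightarrow> 'h::banach \<Rightarrow> 'h" and ip :: "'h \<Rightarrow> 'h \<Rightarrow> 'k" +
  fixes I :: "'i set" and W :: "'i \<Rightarrow> 'h set" and v :: "'i \<Rightarrow> real"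
  assumes W: "i \<in> I \<Longrightarrow> closed_subspace smul (W i)"
begin

definition analysis :: "'h \<Rightarrow> 'i \<Rightarrow> 'h" where
  "analysis f i = (if i \<in> I then v i *\<^sub>R orth_proj ip (W i) f else 0)"

definition synthesis :: "('i \<Rightarrow> 'h) \<Rightarrow> 'h" where
  "synthesis g = (\<Sum>\<^sub>\<infinity>i\<in>I. v i *\<^sub>R g i)"

lemma W_real_subspace: "i \<in> I \<Longrightarrow> Real_Vector_Spaces.subspace (W i)"
  using W[of i] by (simp add: closed_subspace_def real_subspace)

lemma l2_sum_diff:
  assumes "f \<in> l2_sum I W" "g \<in> l2_sum I W"
  shows "(\<lambda>i. f i - g i) \<in> l2_sum I W"
  using assms by (auto simp: l2_sum_def intro: real_vector.subspace_diff[OF W_real_subspace]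
      summable_on_norm_diff_power2)

lemma l2_sum_add:
  assumes "f \<in> l2_sum I W" "g \<in> l2_sum I W"
  shows "(\<lambda>i. f i + g i) \<in> l2_sum I W"
  using assms by (auto simp: l2_sum_def intro: real_vector.subspace_add[OF W_real_subspace]
      summable_on_norm_add_power2)

lemma norm_analysis_power2:
  "i \<in> I \<Longrightarrow> (norm (analysis f i))\<^sup>2 = (v i)\<^sup>2 * (norm (orth_proj ip (W i) f))\<^sup>2"
  by (simp add: analysis_def power_mult_distrib)

lemma analysis_summable_iff:
  "(\<lambda>i. (norm (analysis f i))\<^sup>2) summable_on I \<longleftrightarrow>
   (\<lambda>i. (v i)\<^sup>2 * (norm (orth_proj ip (W i) f))\<^sup>2) summable_on I"
  by (rule summable_on_cong) (rule norm_analysis_power2)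

lemma l2_norm_analysis:
  "(l2_norm I (analysis f))\<^sup>2 = (\<Sum>\<^sub>\<infinity>i\<in>I. (v i)\<^sup>2 * (norm (orth_proj ip (W i) f))\<^sup>2)"
  unfolding l2_norm_power2 by (rule infsum_cong) (rule norm_analysis_power2)

lemma analysis_in_W: "i \<in> I \<Longrightarrow> analysis f i \<in> W i"
  by (simp add: analysis_def orth_proj_mem W real_vector.subspace_scale[OF W_real_subspace])

lemma analysis_in_l2:
  "(\<lambda>i. (norm (analysis f i))\<^sup>2) summable_on I \<Longrightarrow> analysis f \<in> l2_sum I W"
  by (simp add: l2_sum_def analysis_in_W) (simp add: analysis_def)

lemma linear_analysis: "linear (\<lambda>f. analysis f i)"
proof (cases "i \<in> I")
  case True
  then show ?thesis
    using linear_compose_scale_right[OF linear_orth_proj[OF W[OF True]]] by (simp add: analysis_def)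
qed (simp add: analysis_def linear_zero)

lemma rip_analysis:
  assumes "i \<in> I" "w \<in> W i"
  shows "rip (v i *\<^sub>R w) f = rip w (analysis f i)"
  using assms rip_orth_proj_right[OF W[OF assms(1)] assms(2), of f] by (simp add: analysis_def rip_simps)

lemma sum_rip_analysis:
  assumes "\<And>i. i \<in> I \<Longrightarrow> g i \<in> W i" "F \<subseteq> I"
  shows "rip (\<Sum>i\<in>F. v i *\<^sub>R g i) f = (\<Sum>i\<in>F. rip (g i) (analysis f i))"
  unfolding linear_sum[OF bounded_linear.linear[OF bounded_linear_rip_left]]
  by (rule sum.cong) (use assms rip_analysis in auto)

lemma sum_rip_le: "\<bar>\<Sum>i\<in>F. rip (g i) (h i)\<bar> \<le> sqrt (\<Sum>i\<in>F. (norm (g i))\<^sup>2) * sqrt (\<Sum>i\<in>F. (norm (h i))\<^sup>2)"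
proof -
  have "\<bar>\<Sum>i\<in>F. rip (g i) (h i)\<bar> \<le> (\<Sum>i\<in>F. \<bar>rip (g i) (h i)\<bar>)" by (rule sum_abs)
  also have "\<dots> \<le> (\<Sum>i\<in>F. \<bar>norm (g i)\<bar> * \<bar>norm (h i)\<bar>)"
    by (intro sum_mono) (simp add: rip_Cauchy_Schwarz)
  also have "\<dots> \<le> L2_set (\<lambda>i. norm (g i)) F * L2_set (\<lambda>i. norm (h i)) F" by (rule L2_set_mult_ineq)
  finally show ?thesis by (simp add: L2_set_def)
qed

text \<open>Adjointness of synthesis and analysis. It is stated for any sum \<open>y\<close> of the
  weighted family, so that it covers both \<open>synthesis g\<close> and \<open>L g\<close> for a
  given operator \<open>L\<close>.\<close>

lemma has_sum_rip_analysis: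
  assumes "g \<in> l2_sum I W" "((\<lambda>i. v i *\<^sub>R g i) has_sum y) I"
  shows "((\<lambda>i. rip (g i) (analysis f i)) has_sum rip y f) I"
proof -
  have "((\<lambda>i. rip (v i *\<^sub>R g i) f) has_sum rip y f) I"
    by (rule has_sum_bounded_linear[OF bounded_linear_rip_left assms(2)])
  then show ?thesis
    by (rule has_sum_cong[THEN iffD1, rotated]) (use assms(1) in \<open>auto simp: l2_sum_def rip_analysis\<close>)
qed

lemma rip_le_l2_norm_analysis:
  assumes "g \<in> l2_sum I W" "((\<lambda>i. v i *\<^sub>R g i) has_sum y) I"
    and "(\<lambda>i. (norm (analysis f i))\<^sup>2) summable_on I"
  shows "\<bar>rip y f\<bar> \<le> l2_norm I g * l2_norm I (analysis f)"
proof -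
  have "((\<lambda>F. \<bar>\<Sum>i\<in>F. rip (g i) (analysis f i)\<bar>) \<longlongrightarrow> \<bar>rip y f\<bar>) (finite_subsets_at_top I)"
    using has_sum_rip_analysis[OF assms(1,2)] unfolding has_sum_def by (rule tendsto_rabs)
  moreover have "\<bar>\<Sum>i\<in>F. rip (g i) (analysis f i)\<bar> \<le> l2_norm I g * l2_norm I (analysis f)"
    if F: "finite F" "F \<subseteq> I" for F
  proof (rule order_trans[OF sum_rip_le mult_mono])
    show "sqrt (\<Sum>i\<in>F. (norm (g i))\<^sup>2) \<le> l2_norm I g"
      using assms(1) F by (intro real_le_lsqrt sum_norm_le_l2_norm) (auto simp: l2_sum_def intro: sum_nonneg)
    show "sqrt (\<Sum>i\<in>F. (norm (analysis f i))\<^sup>2) \<le> l2_norm I (analysis f)"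
      using assms(3) F by (intro real_le_lsqrt sum_norm_le_l2_norm) (auto intro: sum_nonneg)
  qed (auto intro: sum_nonneg)
  then have "eventually (\<lambda>F. \<bar>\<Sum>i\<in>F. rip (g i) (analysis f i)\<bar> \<le> l2_norm I g * l2_norm I (analysis f))
      (finite_subsets_at_top I)"
    by (intro eventually_finite_subsets_at_top_weakI)
  ultimately show ?thesis
    by (rule tendsto_upperbound) simp
qed

end

section \<open>The synthesis operator under an upper frame bound\<close>

locale bessel_subspaces = weighted_subspaces smul ip I W v
  for smul :: "'k::real_or_complex \<Rightarrow> 'h::banach \<Rightarrow> 'h" and ip :: "'h \<Rightarrow> 'h \<Rightarrow> 'k"
    and I :: "'i set" and W :: "'i \<Rightarrow> 'h set" and v :: "'i \<Rightarrow> real" +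
  fixes B :: real
  assumes B: "0 < B" and summable: "(\<lambda>i. (norm (analysis f i))\<^sup>2) summable_on I"
    and upper: "(l2_norm I (analysis f))\<^sup>2 \<le> B * (norm f)\<^sup>2"
begin

text \<open>Duality: for the partial sum \<open>s\<close>, adjointness and Cauchy-Schwarz bound
  \<open>norm s * norm s\<close> by the l2 norm of \<open>g\<close> on \<open>F\<close> times
  \<open>sqrt B * norm s\<close>, and one factor \<open>norm s\<close> cancels.\<close>

lemma norm_sum_synthesis:
  assumes "\<And>i. i \<in> I \<Longrightarrow> g i \<in> W i" "finite F" "F \<subseteq> I"
  shows "(norm (\<Sum>i\<in>F. v i *\<^sub>R g i))\<^sup>2 \<le> B * (\<Sum>i\<in>F. (norm (g i))\<^sup>2)"
proof -
  define s where "s = (\<Sum>i\<in>F. v i *\<^sub>R g i)"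
  have "(norm s)\<^sup>2 = (\<Sum>i\<in>F. rip (g i) (analysis s i))"
    using sum_rip_analysis[of g F s] assms by (simp add: rip_self s_def)
  also have "\<dots> \<le> sqrt (\<Sum>i\<in>F. (norm (g i))\<^sup>2) * sqrt (\<Sum>i\<in>F. (norm (analysis s i))\<^sup>2)"
    using sum_rip_le[of g "analysis s" F] by linarith
  also have "\<dots> \<le> sqrt (\<Sum>i\<in>F. (norm (g i))\<^sup>2) * sqrt (B * (norm s)\<^sup>2)"
    using sum_norm_le_l2_norm[OF summable, of F s] assms upper[of s]
    by (intro mult_left_mono real_sqrt_le_mono) (auto intro: sum_nonneg)
  also have "\<dots> = sqrt (B * (\<Sum>i\<in>F. (norm (g i))\<^sup>2)) * norm s" by (simp add: real_sqrt_mult)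
  finally have "norm s * norm s \<le> sqrt (B * (\<Sum>i\<in>F. (norm (g i))\<^sup>2)) * norm s"
    by (simp add: power2_eq_square)
  then have "norm s \<le> sqrt (B * (\<Sum>i\<in>F. (norm (g i))\<^sup>2))"
    using B by (cases "s = 0") (auto intro!: sum_nonneg mult_nonneg_nonneg)
  then have "(norm s)\<^sup>2 \<le> (sqrt (B * (\<Sum>i\<in>F. (norm (g i))\<^sup>2)))\<^sup>2" by (intro power_mono) auto
  also have "\<dots> = B * (\<Sum>i\<in>F. (norm (g i))\<^sup>2)" using B by (simp add: sum_nonneg)
  finally show ?thesis by (simp add: s_def)
qed

lemma has_sum_synthesis:
  assumes "g \<in> l2_sum I W"
  shows "((\<lambda>i. v i *\<^sub>R g i) has_sum synthesis g) I"
proof -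
  have "(\<lambda>i. v i *\<^sub>R g i) summable_on I"
    by (rule summable_on_norm_sum_le[where a="\<lambda>i. (norm (g i))\<^sup>2" and C=B])
      (use assms B norm_sum_synthesis[of g] in \<open>auto simp: l2_sum_def\<close>)
  then show ?thesis unfolding synthesis_def by (rule has_sum_infsum)
qed

lemma norm_synthesis_le:
  assumes "g \<in> l2_sum I W"
  shows "norm (synthesis g) \<le> sqrt B * l2_norm I g"
proof -
  let ?s = "synthesis g"
  have "l2_norm I (analysis ?s) \<le> sqrt B * norm ?s"
    by (rule power2_le_imp_le) (use upper[of ?s] B in \<open>auto simp: power_mult_distrib\<close>)
  then have "l2_norm I g * l2_norm I (analysis ?s) \<le> l2_norm I g * (sqrt B * norm ?s)"
    by (intro mult_left_mono) auto
  moreover have "norm ?s * norm ?s \<le> l2_norm I g * l2_norm I (analysis ?s)"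
    using rip_le_l2_norm_analysis[OF assms has_sum_synthesis[OF assms] summable, of ?s]
    by (simp add: rip_self power2_eq_square)
  ultimately have "norm ?s * norm ?s \<le> (sqrt B * l2_norm I g) * norm ?s" by (simp add: mult_ac)
  then show ?thesis using B by (cases "?s = 0") auto
qed

lemma synthesis_add:
  assumes "f \<in> l2_sum I W" "g \<in> l2_sum I W"
  shows "synthesis (\<lambda>i. f i + g i) = synthesis f + synthesis g"
  using has_sum_add[OF has_sum_synthesis[OF assms(1)] has_sum_synthesis[OF assms(2)]]
  unfolding synthesis_def by (simp add: infsumI scaleR_add_right)

lemma synthesis_smul:
  assumes "f \<in> l2_sum I W"
  shows "synthesis (\<lambda>i. smul a (f i)) = smul a (synthesis f)"
  using has_sum_bounded_linear[OF bounded_linear_smul[of a] has_sum_synthesis[OF assms]]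
  unfolding synthesis_def by (simp add: infsumI smul_scaleR_commute)

lemma l2_bounded_op_synthesis: "l2_bounded_op smul I W synthesis"
  unfolding l2_bounded_op_def using synthesis_add synthesis_smul norm_synthesis_le by blast

lemma analysis_mem: "analysis f \<in> l2_sum I W"
  by (rule analysis_in_l2[OF summable])

lemma synthesis_diff:
  assumes "f \<in> l2_sum I W" "g \<in> l2_sum I W"
  shows "synthesis (\<lambda>i. f i - g i) = synthesis f - synthesis g"
  using synthesis_add[OF l2_sum_diff[OF assms] assms(2)] by simp

text \<open>The form of the frame operator, that is the l2 inner product (real part) of
  \<open>analysis f\<close> and \<open>analysis h\<close>. In the present shape linearity in
  \<open>h\<close> is inherited from \<open>rip\<close>.\<close>

definition frame_form :: "'h \<Rightarrow> 'h \<Rightarrow> real" where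
  "frame_form f h = rip (synthesis (analysis f)) h"

lemma has_sum_frame_form: "((\<lambda>i. rip (analysis f i) (analysis h i)) has_sum frame_form f h) I"
  unfolding frame_form_def by (intro has_sum_rip_analysis analysis_mem has_sum_synthesis)

lemma frame_form_commute: "frame_form f h = frame_form h f"
  using has_sum_frame_form[of f h] has_sum_frame_form[of h f]
  by (simp add: rip_commute[of "analysis f _"] has_sum_unique)

lemma frame_form_self: "frame_form f f = (l2_norm I (analysis f))\<^sup>2"
  using infsumI[OF has_sum_frame_form[of f f]] by (simp add: rip_self l2_norm_power2)

lemma bilinear_frame_form: "bilinear frame_form"
proof -
  have 1: "linear (frame_form f)" for f
    using bilinear_rip by (simp add: bilinear_def frame_form_def[abs_def])
  have 2: "linear (\<lambda>f. frame_form f h)" for h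
    using 1[of h] by (subst frame_form_commute)
  show ?thesis using 1 2 by (simp add: bilinear_def)
qed

text \<open>The lower bound makes the functional \<open>rip (K x)\<close> bounded with respect to
  \<open>frame_form\<close>, so the Riesz sequence applies. The \<open>f n\<close> themselves need
  not converge; their images under \<open>analysis\<close> are Cauchy in the direct sum, and
  \<open>synthesis\<close> maps the limit to \<open>K x\<close>.\<close>

lemma range_subset_if_lower_bound:
  assumes K: "bounded_op smul K" and "0 < A"
    and lower: "\<And>f. A * (norm (adjoint_op ip K f))\<^sup>2 \<le> (l2_norm I (analysis f))\<^sup>2"
  shows "range K \<subseteq> synthesis ` l2_sum I W"
proof clarify
  fix x
  obtain f where
    cauchy: "\<And>e. 0 < e \<Longrightarrow> \<exists>M. \<forall>m\<ge>M. \<forall>n\<ge>M. frame_form (f m - f n) (f m - f n) < e"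
    and lim: "\<And>h. (\<lambda>n. frame_form (f n) h) \<longlonglongrightarrow> rip (K x) h"
  proof (rule psd_bilinear_Riesz_sequence[of frame_form "rip (K x)" "(norm x)\<^sup>2 / A" UNIV])
    show "(rip (K x) h)\<^sup>2 \<le> (norm x)\<^sup>2 / A * frame_form h h" for h
    proof -
      have "(rip (K x) h)\<^sup>2 \<le> (norm x)\<^sup>2 * (norm (adjoint_op ip K h))\<^sup>2"
        using power_mono[OF rip_Cauchy_Schwarz[of x "adjoint_op ip K h"], of 2]
        by (simp add: rip_adjoint_op[OF K] power_mult_distrib)
      also have "\<dots> \<le> (norm x)\<^sup>2 * ((l2_norm I (analysis h))\<^sup>2 / A)"
        using lower[of h] \<open>0 < A\<close> by (intro mult_left_mono) (auto simp: field_simps)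
      finally show ?thesis by (simp add: frame_form_self)
    qed
    show "linear (rip (K x))" using bilinear_rip by (simp add: bilinear_def)
    show "frame_form x y = frame_form y x" for x y by (rule frame_form_commute)
  qed (use \<open>0 < A\<close> in \<open>auto simp: bilinear_frame_form frame_form_self\<close>)
  obtain h where h: "h \<in> l2_sum I W" "(\<lambda>n. \<Sum>\<^sub>\<infinity>i\<in>I. (norm (analysis (f n) i - h i))\<^sup>2) \<longlonglongrightarrow> 0"
  proof (rule l2_sum_complete[of I W "\<lambda>n. analysis (f n)"])
    fix e :: real assume "0 < e"
    then show "\<exists>M. \<forall>m\<ge>M. \<forall>n\<ge>M. (\<Sum>\<^sub>\<infinity>i\<in>I. (norm (analysis (f m) i - analysis (f n) i))\<^sup>2) < e"
      using cauchy[of e] by (simp add: frame_form_self l2_norm_power2 linear_diff[OF linear_analysis])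
  qed (use W analysis_mem in \<open>auto simp: closed_subspace_def\<close>)
  \<comment> \<open>Continuity of \<open>synthesis\<close> identifies the limit of
    \<open>synthesis (analysis (f n))\<close>, whose real products with \<open>u\<close> are already
    known to tend to \<open>rip (K x) u\<close>.\<close>
  have "(\<lambda>n. l2_norm I (\<lambda>i. analysis (f n) i - h i)) \<longlonglongrightarrow> 0"
    using tendsto_real_sqrt[OF h(2)] by (simp add: l2_norm_def)
  then have "(\<lambda>n. sqrt B * l2_norm I (\<lambda>i. analysis (f n) i - h i)) \<longlonglongrightarrow> 0"
    by (rule tendsto_mult_right_zero)
  then have "(\<lambda>n. synthesis (analysis (f n)) - synthesis h) \<longlonglongrightarrow> 0"
    by (rule Lim_null_comparison[rotated])
      (simp add: synthesis_diff[symmetric] norm_synthesis_le l2_sum_diff analysis_mem h(1))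
  then have "(\<lambda>n. synthesis (analysis (f n))) \<longlonglongrightarrow> synthesis h"
    by (simp add: LIM_zero_iff)
  then have "(\<lambda>n. frame_form (f n) u) \<longlonglongrightarrow> rip (synthesis h) u" for u
    unfolding frame_form_def by (rule bounded_linear.tendsto[OF bounded_linear_rip_left])
  then have eq: "rip (synthesis h) u = rip (K x) u" for u
    using lim LIMSEQ_unique by blast
  have "rip (synthesis h - K x) (synthesis h - K x) = 0"
    using eq by (simp add: bilinear_lsub[OF bilinear_rip])
  then have "K x = synthesis h" by (simp add: rip_self)
  then show "K x \<in> synthesis ` l2_sum I W" using h(1) by blast
qed

end

subsection \<open>Uniform boundedness and Gram--Schmidt\<close>

text \<open>By Baire's theorem one of the closed sets \<open>A n\<close>, which cover the space,
  contains a ball; linearity spreads the bound from the ball to all vectors.\<close>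

lemma uniform_boundedness:
  fixes T :: "'s \<Rightarrow> 'a::banach \<Rightarrow> 'b::real_normed_vector"
  assumes T: "\<And>s. s \<in> S \<Longrightarrow> bounded_linear (T s)"
    and pointwise: "\<And>x. \<exists>c. \<forall>s\<in>S. norm (T s x) \<le> c"
  obtains C where "0 \<le> C" "\<And>s x. s \<in> S \<Longrightarrow> norm (T s x) \<le> C * norm x"
proof -
  define A where "A n = {x. \<forall>s\<in>S. norm (T s x) \<le> real n}" for n
  have "closed (A n)" for n
  proof -
    have "A n = (\<Inter>s\<in>S. {x. norm (T s x) \<le> real n})" by (auto simp: A_def)
    moreover have "closed {x. norm (T s x) \<le> real n}" if "s \<in> S" for s
      by (intro closed_Collect_le continuous_intros linear_continuous_on T that)
    ultimately show ?thesis by auto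
  qed
  moreover have "x \<in> (\<Union>n. A n)" for x
  proof -
    obtain c where "\<forall>s\<in>S. norm (T s x) \<le> c" using pointwise by blast
    then have "x \<in> A (nat \<lceil>c\<rceil>)" unfolding A_def by (auto intro: order_trans real_nat_ceiling_ge)
    then show ?thesis by blast
  qed
  then have "(\<Union>n. A n) = UNIV" by blast
  ultimately have "\<exists>n. interior (A n) \<noteq> {}"
    using Met_TC.metric_Baire_category_alt[of "range A"] complete_UNIV
    by auto
  then obtain n x0 where "x0 \<in> interior (A n)" by blast
  then obtain r where r: "0 < r" "cball x0 r \<subseteq> A n" by (auto simp: mem_interior_cball)
  have "norm (T s x) \<le> 2 * real n / r * norm x" if "s \<in> S" for s x
  proof (cases "x = 0")
    case True
    then show ?thesis using linear_0[OF bounded_linear.linear[OF T[OF that]]] by simp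
  next
    case False
    interpret bounded_linear "T s" by (rule T[OF that])
    \<comment> \<open>Rescaled to norm \<open>r\<close>, so that \<open>x0 + y\<close> stays in the
      ball and \<open>T s y\<close> is a difference of two values of norm at most
      \<open>n\<close>.\<close>
    define y where "y = (r / norm x) *\<^sub>R x"
    have "norm y = r" using False r by (simp add: y_def)
    then have "x0 + y \<in> A n" "x0 \<in> A n" using r by (auto simp: dist_norm)
    then have "norm (T s (x0 + y)) \<le> n" "norm (T s x0) \<le> n" using that by (auto simp: A_def)
    moreover have "T s y = T s (x0 + y) - T s x0" by (simp add: add)
    ultimately have "norm (T s y) \<le> 2 * real n" 
      using norm_triangle_ineq4[of "T s (x0 + y)" "T s x0"] by simp
    moreover have "norm (T s y) = r / norm x * norm (T s x)" using r by (simp add: y_def scaleR)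
    ultimately show ?thesis using r False by (simp add: field_simps)
  qed
  then show thesis using r by (intro that[of "2 * real n / r"]) auto
qed

section \<open>Gram-Schmidt orthonormalisation in a closed subspace\<close>

context hilbert_space
begin

text \<open>A vector in the span of its predecessors leaves the residual 0 and yields the zero
  vector instead of being skipped, so indices stay aligned with \<open>d\<close>.\<close>

function gram_schmidt :: "(nat \<Rightarrow> 'h) \<Rightarrow> nat \<Rightarrow> 'h" where
  "gram_schmidt d n =
     (let r = d n - (\<Sum>m<n. smul (ip (d n) (gram_schmidt d m)) (gram_schmidt d m))
      in (1 / norm r) *\<^sub>R r)"
  by pat_completeness auto
termination by (relation "Wellfounded.measure snd") auto

declare gram_schmidt.simps [simp del]

lemma gram_schmidt_residual:
  fixes d :: "nat \<Rightarrow> 'h"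
  defines "r \<equiv> \<lambda>n. d n - (\<Sum>m<n. smul (ip (d n) (gram_schmidt d m)) (gram_schmidt d m))"
  shows "gram_schmidt d n = smul (of_real (1 / norm (r n))) (r n)"
    and "r n = smul (of_real (norm (r n))) (gram_schmidt d n)"
  unfolding smul_of_real by (auto simp: gram_schmidt.simps[of d n] Let_def r_def)

lemma gram_schmidt_unit: "gram_schmidt d n = 0 \<or> norm (gram_schmidt d n) = 1"
  by (simp add: gram_schmidt.simps[of d n] Let_def)

lemma gram_schmidt_orthogonal: "m < n \<Longrightarrow> ip (gram_schmidt d n) (gram_schmidt d m) = 0"
proof (induction n arbitrary: m rule: less_induct)
  case (less n)
  let ?e = "gram_schmidt d"
  have orth: "ip (?e k) (?e m) = 0" if "k < n" "k \<noteq> m" for k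
  proof (cases "k < m")
    case True
    then have "ip (?e m) (?e k) = 0" using less by blast
    then show ?thesis by (metis ip_commute conjg_0)
  next
    case False
    then show ?thesis using less that by auto
  qed
  \<comment> \<open>True for a unit vector \<open>?e m\<close>, and for \<open>?e m = 0\<close>
    because both sides vanish.\<close>
  have unit: "ip (d n) (?e m) * ip (?e m) (?e m) = ip (d n) (?e m)"
    using gram_schmidt_unit[of d m] by (auto simp: ip_self)
  have "(\<Sum>k<n. ip (d n) (?e k) * ip (?e k) (?e m)) = (\<Sum>k<n. if k = m then ip (d n) (?e m) else 0)"
    by (rule sum.cong) (auto simp: orth unit)
  also have "\<dots> = ip (d n) (?e m)" using less.prems by simp
  finally have "ip (d n - (\<Sum>k<n. smul (ip (d n) (?e k)) (?e k))) (?e m) = 0"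
    by (simp add: ip_diff_left ip_sum_left ip_smul_left)
  then show ?case
    by (subst gram_schmidt_residual(1)) (simp only: ip_smul_left mult_zero_right)
qed

lemma gram_schmidt_mem:
  assumes "subspace V" "\<And>n. d n \<in> V"
  shows "gram_schmidt d n \<in> V"
proof (induction n rule: less_induct)
  case (less n)
  then show ?case
    by (subst gram_schmidt_residual(1)) (intro subspace_scale subspace_diff subspace_sum assms; simp)
qed

lemma gram_schmidt_span: "\<exists>c. d n = (\<Sum>m<Suc n. smul (c m) (gram_schmidt d m))"
proof -
  let ?e = "gram_schmidt d"
  let ?r = "d n - (\<Sum>m<n. smul (ip (d n) (?e m)) (?e m))"
  let ?c = "\<lambda>m. if m < n then ip (d n) (?e m) else of_real (norm ?r)"
  have "d n = (\<Sum>m<n. smul (ip (d n) (?e m)) (?e m)) + ?r" by simp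
  also have "?r = smul (of_real (norm ?r)) (?e n)" by (rule gram_schmidt_residual(2))
  finally have "d n = (\<Sum>m<Suc n. smul (?c m) (?e m))" by simp
  then show ?thesis by (rule exI[of _ ?c])
qed

text \<open>Projections of a countable dense set of the whole space are dense in \<open>V\<close>;
  Gram-Schmidt is run on \<open>u\<close> followed by these projections. The case
  \<open>u = 0\<close> serves coordinates in which no first vector is prescribed.\<close>

lemma ex_orthonormal_sequence:
  assumes V: "closed_subspace smul V" and "u \<in> V" "norm u = 1 \<or> u = 0"
    and sep: "\<exists>D :: 'h set. countable D \<and> closure D = UNIV"
  obtains b :: "nat \<Rightarrow> 'h" where "b 0 = u" "\<And>n. b n \<in> V" "\<And>n. b n = 0 \<or> norm (b n) = 1"
    "\<And>m n. m \<noteq> n \<Longrightarrow> ip (b m) (b n) = 0"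
    "\<And>w e. w \<in> V \<Longrightarrow> 0 < e \<Longrightarrow> \<exists>n c. norm (w - (\<Sum>m<n. smul (c m) (b m))) < e"
proof -
  obtain D :: "'h set" where D: "countable D" "closure D = UNIV" using sep by blast
  then have "D \<noteq> {}" by auto
  define d where "d n = (case n of 0 \<Rightarrow> u | Suc k \<Rightarrow> orth_proj ip V (from_nat_into D k))" for n
  have d_mem: "d n \<in> V" for n
    using assms(2) orth_proj_mem[OF V] by (simp add: d_def split: nat.split)
  have subV: "subspace V" using V by (simp add: closed_subspace_def)
  show thesis
  proof
    show "gram_schmidt d 0 = u"
      using assms(3) by (auto simp: gram_schmidt.simps[of d 0] d_def)
    show "gram_schmidt d n \<in> V" for n by (rule gram_schmidt_mem[OF subV d_mem])
    show "gram_schmidt d n = 0 \<or> norm (gram_schmidt d n) = 1" for n by (rule gram_schmidt_unit)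
    show "ip (gram_schmidt d m) (gram_schmidt d n) = 0" if "m \<noteq> n" for m n
      using that gram_schmidt_orthogonal[of n m d] gram_schmidt_orthogonal[of m n d]
      by (metis ip_commute conjg_0 nat_neq_iff)
    show "\<exists>n c. norm (w - (\<Sum>m<n. smul (c m) (gram_schmidt d m))) < e" if w: "w \<in> V" "0 < e" for w e
    proof -
      have "w \<in> closure D" using D by simp
      then obtain x where x: "x \<in> D" "dist x w < e" using w(2) closure_approachable by blast
      obtain k where k: "from_nat_into D k = x"
        using from_nat_into_surj[OF D(1) x(1)] by blast
      obtain c where c: "d (Suc k) = (\<Sum>m<Suc (Suc k). smul (c m) (gram_schmidt d m))"
        using gram_schmidt_span[of d "Suc k"] by blast
      \<comment> \<open>\<open>w\<close> is its own projection, and projecting does not increase the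
        distance to \<open>x\<close>.\<close>
      have "w - d (Suc k) = orth_proj ip V (w - x)"
        using k orth_proj_ident[OF V w(1)] linear_diff[OF linear_orth_proj[OF V]] by (simp add: d_def)
      then have "norm (w - d (Suc k)) < e"
        using norm_orth_proj_le[OF V, of "w - x"] x by (simp add: dist_norm norm_minus_commute)
      then show ?thesis unfolding c by (intro exI)
    qed
  qed
qed

end

subsection \<open>Orthonormal bases of the direct sum\<close>

lemma has_sum_single:
  fixes f :: "'i \<Rightarrow> 'a::{comm_monoid_add, topological_space}"
  assumes "j \<in> I" "\<And>i. i \<in> I \<Longrightarrow> i \<noteq> j \<Longrightarrow> f i = 0"
  shows "(f has_sum f j) I"
proof -
  have "(f has_sum sum f {j}) {j}" by (rule has_sum_finite) simp
  then have "(f has_sum f j) {j}" by simp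
  then show ?thesis
    by (rule has_sum_cong_neutral[THEN iffD1, rotated 3]) (use assms in auto)
qed

definition single :: "'i \<Rightarrow> 'h::zero \<Rightarrow> 'i \<Rightarrow> 'h" where
  "single j x = (\<lambda>i. if i = j then x else 0)"

context weighted_subspaces
begin

lemma single_in_l2_sum:
  assumes "j \<in> I" "x \<in> W j"
  shows "single j x \<in> l2_sum I W"
proof -
  have "((\<lambda>i. (norm (single j x i))\<^sup>2) has_sum (norm (single j x j))\<^sup>2) I"
    by (rule has_sum_single) (use assms in \<open>auto simp: single_def\<close>)
  then have "(\<lambda>i. (norm (single j x i))\<^sup>2) summable_on I" by (rule has_sum_imp_summable)
  then show ?thesis
    using assms real_vector.subspace_0[OF W_real_subspace] by (auto simp: l2_sum_def single_def)
qed

lemma l2_ip_single: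
  assumes "j \<in> I"
  shows "l2_ip ip I (single j x) (single k y) = (if j = k then ip x y else 0)"
proof -
  have "((\<lambda>i. ip (single j x i) (single k y i)) has_sum ip (single j x j) (single k y j)) I"
    by (rule has_sum_single) (use assms in \<open>auto simp: single_def\<close>)
  then show ?thesis
    unfolding l2_ip_def by (subst infsumI) (auto simp: single_def)
qed

text \<open>Orthonormal bases of the \<open>W j\<close> are put side by side; the vector \<open>b j m\<close> gets the number
  \<^term>\<open>prod_encode (to_nat_on I j, m)\<close>.\<close>

lemma ex_basis_containing_single:
  assumes "countable I" and sep: "\<exists>D :: 'h set. countable D \<and> closure D = UNIV"
    and "i \<in> I" "u \<in> W i" "norm u = 1"
  obtains N e n where "l2_orthonormal_basis smul ip I W N e" "n \<in> N" "e n = single i u"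
proof -
  define good where "good j b \<longleftrightarrow> (j = i \<longrightarrow> b 0 = u) \<and> (\<forall>n. b n \<in> W j) \<and>
      (\<forall>n. b n = 0 \<or> norm (b n) = 1) \<and> (\<forall>m n. m \<noteq> n \<longrightarrow> ip (b m) (b n) = 0) \<and>
      (\<forall>w\<in>W j. \<forall>\<delta>>0. \<exists>n c. norm (w - (\<Sum>m<n. smul (c m) (b m))) < \<delta>)"
    for j and b :: "nat \<Rightarrow> 'h"
  have "\<exists>b. good j b" if "j \<in> I" for j
  proof -
    \<comment> \<open>Only coordinate \<open>i\<close> starts from \<open>u\<close>; the others
      start from 0, which prescribes nothing.\<close>
    have mem: "(if j = i then u else 0) \<in> W j"
      using assms real_vector.subspace_0[OF W_real_subspace[OF that]] by auto
    have unit: "norm (if j = i then u else 0) = 1 \<or> (if j = i then u else 0) = 0"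
      using assms by auto
    show ?thesis
    proof (rule ex_orthonormal_sequence[OF W[OF that] mem unit sep])
      fix b :: "nat \<Rightarrow> 'h"
      assume "b 0 = (if j = i then u else 0)" "\<And>n. b n \<in> W j"
        "\<And>n. b n = 0 \<or> norm (b n) = 1" "\<And>m n. m \<noteq> n \<Longrightarrow> ip (b m) (b n) = 0"
        "\<And>w e. w \<in> W j \<Longrightarrow> 0 < e \<Longrightarrow> \<exists>n c. norm (w - (\<Sum>m<n. smul (c m) (b m))) < e"
      then show ?thesis by (intro exI[of _ b]) (simp add: good_def)
    qed
  qed
  then obtain b where "\<And>j. j \<in> I \<Longrightarrow> good j (b j)" by metis
  note b = this[unfolded good_def]
  define code where "code j m = prod_encode (to_nat_on I j, m)" for j and m :: nat
  define dec where "dec k = (from_nat_into I (fst (prod_decode k)), snd (prod_decode k))" for k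
  have dec_code: "dec (code j m) = (j, m)" if "j \<in> I" for j m
    using that \<open>countable I\<close> by (simp add: dec_def code_def)
  define e where "e k = single (fst (dec k)) (b (fst (dec k)) (snd (dec k)))" for k
  have e_code: "e (code j m) = single j (b j m)" if "j \<in> I" for j m
    using that by (simp add: e_def dec_code)
  \<comment> \<open>The zero vectors left by Gram-Schmidt are dropped here.\<close>
  define N where "N = {k. \<exists>j\<in>I. \<exists>m. k = code j m \<and> b j m \<noteq> 0}"
  have "l2_orthonormal_basis smul ip I W N e"
    unfolding l2_orthonormal_basis_def
  proof (intro conjI ballI allI impI)
    show "e n \<in> l2_sum I W" if "n \<in> N" for n
      using that b by (auto simp: N_def e_code single_in_l2_sum)
    show "l2_ip ip I (e m) (e n) = (if m = n then 1 else 0)" if mn: "m \<in> N" "n \<in> N" for m n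
    proof -
      obtain j p where m: "j \<in> I" "m = code j p" "b j p \<noteq> 0" using mn(1) by (auto simp: N_def)
      obtain k q where n: "k \<in> I" "n = code k q" "b k q \<noteq> 0" using mn(2) by (auto simp: N_def)
      have "m = n \<longleftrightarrow> j = k \<and> p = q" using dec_code m n by (metis prod.inject)
      moreover have "ip (b j p) (b j p) = 1" using b[OF m(1)] m(3) by (auto simp: ip_self)
      moreover have "ip (b j p) (b j q) = 0" if "p \<noteq> q" using b[OF m(1)] that by blast
      ultimately show ?thesis using m n by (auto simp: e_code l2_ip_single)
    qed
    fix f \<epsilon> assume f: "f \<in> l2_sum I W" and "0 < (\<epsilon>::real)"
    have f_sq: "(\<lambda>i. (norm (f i))\<^sup>2) summable_on I" using f by (simp add: l2_sum_def)
    obtain J where J: "finite J" "J \<subseteq> I" "(\<Sum>\<^sub>\<infinity>i\<in>I - J. (norm (f i))\<^sup>2) < \<epsilon>\<^sup>2 / 2"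
      using infsum_tail_less[OF f_sq, of "\<epsilon>\<^sup>2 / 2"] \<open>0 < \<epsilon>\<close> by auto
    \<comment> \<open>Half of the squared error is spent on the tail outside \<open>J\<close>, the
      other half is shared by the coordinates in \<open>J\<close>. The added 1 keeps
      \<open>\<delta>\<close> positive for empty \<open>J\<close>.\<close>
    define \<delta> where "\<delta> = \<epsilon> / sqrt (2 * (real (card J) + 1))"
    have "0 < \<delta>" using \<open>0 < \<epsilon>\<close> by (simp add: \<delta>_def)
    have "\<exists>n c. norm (f j - (\<Sum>m<n. smul (c m) (b j m))) < \<delta>" if "j \<in> J" for j
      using b[of j] f J that \<open>0 < \<delta>\<close> by (auto simp: l2_sum_def)
    then obtain n c where nc: "\<And>j. j \<in> J \<Longrightarrow> norm (f j - (\<Sum>m<n j. smul (c j m) (b j m))) < \<delta>"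
      by metis
    define X where "X = Sigma J (\<lambda>j. {..<n j})"
    define G where "G = (\<lambda>(j, m). code j m) ` X"
    define a where "a k = c (fst (dec k)) (snd (dec k))" for k
    have "finite X" using J by (simp add: X_def)
    have "inj_on (\<lambda>(j, m). code j m) X"
    proof (rule inj_on_inverseI[of _ dec])
      show "dec (case x of (j, m) \<Rightarrow> code j m) = x" if "x \<in> X" for x
        using that J dec_code by (auto simp: X_def)
    qed
    \<comment> \<open>Intersecting with \<open>N\<close> removes only zero terms, and injectivity of
      the coding on \<open>X\<close> permits summation coordinate by coordinate.\<close>
    have approx: "(\<Sum>k\<in>G \<inter> N. smul (a k) (e k i)) = (if i \<in> J then \<Sum>m<n i. smul (c i m) (b i m) else 0)" for i
    proof -
      have "(\<Sum>k\<in>G \<inter> N. smul (a k) (e k i)) = (\<Sum>k\<in>G. smul (a k) (e k i))"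
      proof (rule sum.mono_neutral_left)
        show "finite G" using \<open>finite X\<close> by (simp add: G_def)
        show "\<forall>k\<in>G - G \<inter> N. smul (a k) (e k i) = 0"
        proof
          fix k assume k: "k \<in> G - G \<inter> N"
          then obtain j m where jm: "j \<in> J" "k = code j m" by (auto simp: G_def X_def)
          then have "b j m = 0" using k J by (auto simp: N_def)
          then show "smul (a k) (e k i) = 0" using jm J by (auto simp: e_code single_def)
        qed
      qed simp
      also have "\<dots> = (\<Sum>(j, m)\<in>X. smul (c j m) (single j (b j m) i))"
        unfolding G_def sum.reindex[OF \<open>inj_on _ X\<close>]
        by (rule sum.cong) (use J in \<open>auto simp: X_def a_def dec_code e_code\<close>)
      also have "\<dots> = (\<Sum>j\<in>J. \<Sum>m<n j. smul (c j m) (single j (b j m) i))"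
        unfolding X_def using J by (subst sum.Sigma) auto
      also have "\<dots> = (\<Sum>j\<in>J. if j = i then \<Sum>m<n i. smul (c i m) (b i m) else 0)"
        by (rule sum.cong) (auto simp: single_def)
      also have "\<dots> = (if i \<in> J then \<Sum>m<n i. smul (c i m) (b i m) else 0)"
        using J by (simp add: sum.delta)
      finally show ?thesis .
    qed
    let ?r = "\<lambda>i. f i - (\<Sum>k\<in>G \<inter> N. smul (a k) (e k i))"
    have tail: "(norm (?r i))\<^sup>2 = (norm (f i))\<^sup>2" if "i \<in> I - J" for i using that by (simp add: approx)
    have "(\<lambda>i. (norm (f i))\<^sup>2) summable_on I - J"
      by (rule summable_on_subset_banach[OF f_sq]) simp
    then have tail_summable: "(\<lambda>i. (norm (?r i))\<^sup>2) summable_on I - J"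
      by (subst summable_on_cong[OF tail])
    have "(\<Sum>\<^sub>\<infinity>i\<in>J \<union> (I - J). (norm (?r i))\<^sup>2) =
        (\<Sum>\<^sub>\<infinity>i\<in>J. (norm (?r i))\<^sup>2) + (\<Sum>\<^sub>\<infinity>i\<in>I - J. (norm (?r i))\<^sup>2)"
      by (rule infsum_Un_disjoint) (use J tail_summable in auto)
    also have "J \<union> (I - J) = I" using J by auto
    also have "(\<Sum>\<^sub>\<infinity>i\<in>J. (norm (?r i))\<^sup>2) = (\<Sum>i\<in>J. (norm (?r i))\<^sup>2)" using J by simp
    also have "(\<Sum>\<^sub>\<infinity>i\<in>I - J. (norm (?r i))\<^sup>2) = (\<Sum>\<^sub>\<infinity>i\<in>I - J. (norm (f i))\<^sup>2)"
      by (rule infsum_cong) (rule tail)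
    finally have split: "(l2_norm I ?r)\<^sup>2 = (\<Sum>i\<in>J. (norm (?r i))\<^sup>2) + (\<Sum>\<^sub>\<infinity>i\<in>I - J. (norm (f i))\<^sup>2)"
      by (simp only: l2_norm_power2)
    have "(\<Sum>i\<in>J. (norm (?r i))\<^sup>2) \<le> real (card J) * \<delta>\<^sup>2"
    proof (rule sum_bounded_above)
      show "(norm (?r i))\<^sup>2 \<le> \<delta>\<^sup>2" if "i \<in> J" for i
        using nc[OF that] that by (intro power_mono) (auto simp: approx)
    qed
    also have "\<dots> \<le> (real (card J) + 1) * \<delta>\<^sup>2" by (intro mult_right_mono) auto
    also have "\<dots> = \<epsilon>\<^sup>2 / 2" by (simp add: \<delta>_def power_divide field_simps)
    finally have "(l2_norm I ?r)\<^sup>2 < \<epsilon>\<^sup>2" using split J by simp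
    then have "l2_norm I ?r < \<epsilon>" by (rule power2_less_imp_less) (use \<open>0 < \<epsilon>\<close> in simp)
    moreover have "finite (G \<inter> N)" using \<open>finite X\<close> by (simp add: G_def)
    ultimately show "\<exists>F c. finite F \<and> F \<subseteq> N \<and> l2_norm I (\<lambda>i. f i - (\<Sum>n\<in>F. smul (c n) (e n i))) < \<epsilon>"
      by (intro exI[of _ "G \<inter> N"] exI[of _ a]) auto
  qed
  moreover have bi: "b i 0 = u" using b[OF \<open>i \<in> I\<close>] by blast
  then have "b i 0 \<noteq> 0" using assms(5) by auto
  then have "code i 0 \<in> N" using \<open>i \<in> I\<close> unfolding N_def by blast
  moreover have "e (code i 0) = single i u" using bi by (simp add: e_code \<open>i \<in> I\<close>)
  ultimately show thesis by (rule that)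
qed

end

subsection \<open>The operator determined by its values on orthonormal bases\<close>

context weighted_subspaces
begin

text \<open>The condition on bases fixes \<open>L\<close> on vectors supported in one coordinate,
  after normalisation. Additivity gives the finite truncations of \<open>g\<close>, whose images are
  the partial sums, and boundedness of \<open>L\<close> controls the tail.\<close>

lemma has_sum_if_basis:
  assumes "countable I" and sep: "\<exists>D :: 'h set. countable D \<and> closure D = UNIV"
    and L: "l2_bounded_op smul I W L"
    and basis: "\<And>N e n. l2_orthonormal_basis smul ip I W N e \<Longrightarrow> n \<in> N \<Longrightarrow>
      ((\<lambda>i. v i *\<^sub>R e n i) has_sum L (e n)) I"
    and g: "g \<in> l2_sum I W"
  shows "((\<lambda>i. v i *\<^sub>R g i) has_sum L g) I"
proof -
  have L_add: "L (\<lambda>i. f i + g i) = L f + L g" if "f \<in> l2_sum I W" "g \<in> l2_sum I W" for f g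
    using L that by (simp add: l2_bounded_op_def)
  have L_smul: "L (\<lambda>i. smul a (f i)) = smul a (L f)" if "f \<in> l2_sum I W" for f a
    using L that by (simp add: l2_bounded_op_def)
  obtain C0 where C0: "\<And>f. f \<in> l2_sum I W \<Longrightarrow> norm (L f) \<le> C0 * l2_norm I f"
    using L unfolding l2_bounded_op_def by blast
  \<comment> \<open>The maximum makes the constant positive, as the quotient
    \<open>\<epsilon> / C\<close> requires.\<close>
  define C where "C = max C0 1"
  have C: "norm (L f) \<le> C * l2_norm I f" if "f \<in> l2_sum I W" for f
    using C0[OF that] mult_right_mono[of C0 C "l2_norm I f"] by (simp add: C_def)
  have zero: "(\<lambda>i. 0) \<in> l2_sum I W"
    using l2_sum_diff[OF g g] by simp
  have L_zero: "L (\<lambda>i. 0) = 0" using C[OF zero] by (simp add: l2_norm_def)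
  have L_single: "L (single j w) = v j *\<^sub>R w" if j: "j \<in> I" "w \<in> W j" for j w
  proof (cases "w = 0")
    case True
    then have "single j w = (\<lambda>i. 0)" by (auto simp: single_def)
    then show ?thesis using L_zero True by simp
  next
    case False
    define u where "u = (1 / norm w) *\<^sub>R w"
    have u: "u \<in> W j" "norm u = 1"
      using False j by (auto simp: u_def intro: real_vector.subspace_scale[OF W_real_subspace])
    obtain N e n where e: "l2_orthonormal_basis smul ip I W N e" "n \<in> N" "e n = single j u"
      using ex_basis_containing_single[OF assms(1) sep j(1) u] by blast
    have "((\<lambda>i. v i *\<^sub>R single j u i) has_sum L (single j u)) I"
      using basis[OF e(1,2)] by (simp only: e(3))
    moreover have "((\<lambda>i. v i *\<^sub>R single j u i) has_sum v j *\<^sub>R single j u j) I"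
      by (rule has_sum_single) (use j in \<open>auto simp: single_def\<close>)
    ultimately have Lu: "L (single j u) = v j *\<^sub>R u"
      using has_sum_unique by (fastforce simp: single_def)
    have "single j w = (\<lambda>i. smul (of_real (norm w)) (single j u i))"
      using False by (auto simp: single_def u_def smul_of_real)
    then have "L (single j w) = smul (of_real (norm w)) (L (single j u))"
      using L_smul[OF single_in_l2_sum[OF j(1) u(1)]] by simp
    also have "\<dots> = norm w *\<^sub>R v j *\<^sub>R u" by (simp only: Lu smul_of_real)
    finally show ?thesis using False by (simp add: u_def)
  qed
  define cut where "cut F = (\<lambda>i. if i \<in> F then g i else 0)" for F
  have cut: "cut F \<in> l2_sum I W \<and> L (cut F) = (\<Sum>i\<in>F. v i *\<^sub>R g i)" if "finite F" "F \<subseteq> I" for F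
    using that
  proof (induction F rule: finite_induct)
    case empty
    then show ?case using zero L_zero by (simp add: cut_def)
  next
    case (insert j F)
    have j: "j \<in> I" "g j \<in> W j" using g insert.prems by (auto simp: l2_sum_def)
    have "cut (insert j F) = (\<lambda>i. single j (g j) i + cut F i)"
      using insert.hyps by (auto simp: cut_def single_def)
    then show ?case
      using insert j L_add[OF single_in_l2_sum[OF j]] l2_sum_add[OF single_in_l2_sum[OF j]]
      by (simp add: L_single)
  qed
  have g_sq: "(\<lambda>i. (norm (g i))\<^sup>2) summable_on I" using g by (simp add: l2_sum_def)
  have error: "norm ((\<Sum>i\<in>F. v i *\<^sub>R g i) - L g) \<le> C * sqrt (\<Sum>\<^sub>\<infinity>i\<in>I - F. (norm (g i))\<^sup>2)"
    if F: "finite F" "F \<subseteq> I" for F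
  proof -
    have diff: "(\<lambda>i. g i - cut F i) \<in> l2_sum I W" using l2_sum_diff g cut[OF F] by blast
    have "L g = L (\<lambda>i. g i - cut F i) + L (cut F)"
      using L_add[OF diff, of "cut F"] cut[OF F] by simp
    then have "norm ((\<Sum>i\<in>F. v i *\<^sub>R g i) - L g) = norm (L (\<lambda>i. g i - cut F i))"
      using cut[OF F] by simp
    also have "\<dots> \<le> C * l2_norm I (\<lambda>i. g i - cut F i)" by (rule C[OF diff])
    also have "l2_norm I (\<lambda>i. g i - cut F i) = sqrt (\<Sum>\<^sub>\<infinity>i\<in>I - F. (norm (g i))\<^sup>2)"
      unfolding l2_norm_def by (intro arg_cong[where f=sqrt] infsum_cong_neutral) (auto simp: cut_def)
    finally show ?thesis .
  qed
  have "1 \<le> C" by (simp add: C_def)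
  show ?thesis
    unfolding has_sum_def
  proof (rule tendstoI)
    fix \<epsilon> :: real assume "0 < \<epsilon>"
    then obtain F0 where F0: "finite F0" "F0 \<subseteq> I"
        and small: "(\<Sum>\<^sub>\<infinity>i\<in>I - F0. (norm (g i))\<^sup>2) < (\<epsilon> / C)\<^sup>2"
      using infsum_tail_less[OF g_sq, of "(\<epsilon> / C)\<^sup>2"] \<open>1 \<le> C\<close> by auto
    have "dist (\<Sum>i\<in>F. v i *\<^sub>R g i) (L g) < \<epsilon>" if F: "finite F" "F0 \<subseteq> F" "F \<subseteq> I" for F
    proof -
      have "(\<Sum>\<^sub>\<infinity>i\<in>I - F. (norm (g i))\<^sup>2) \<le> (\<Sum>\<^sub>\<infinity>i\<in>I - F0. (norm (g i))\<^sup>2)"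
        using F by (intro infsum_mono2 summable_on_subset_banach[OF g_sq]) auto
      then have "sqrt (\<Sum>\<^sub>\<infinity>i\<in>I - F. (norm (g i))\<^sup>2) < \<epsilon> / C"
        using small \<open>0 < \<epsilon>\<close> \<open>1 \<le> C\<close> by (intro real_less_lsqrt) (auto intro: infsum_nonneg)
      then have "C * sqrt (\<Sum>\<^sub>\<infinity>i\<in>I - F. (norm (g i))\<^sup>2) < \<epsilon>"
        using \<open>1 \<le> C\<close> by (simp add: field_simps)
      then show ?thesis using error[OF F(1,3)] by (simp add: dist_norm)
    qed
    then show "\<forall>\<^sub>F F in finite_subsets_at_top I. dist (\<Sum>i\<in>F. v i *\<^sub>R g i) (L g) < \<epsilon>"
      using F0 by (auto simp: eventually_finite_subsets_at_top)
  qed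
qed

text \<open>Truncating \<open>analysis f\<close> to a finite \<open>F\<close> gives an element
  \<open>g\<close> of the direct sum before any summability is known. With \<open>s\<close> its sum
  of squares, \<open>s = rip (L g) f \<le> C * sqrt s * norm f\<close>, and \<open>sqrt s\<close>
  cancels.\<close>

lemma bessel_if_bounded:
  assumes C: "0 \<le> C" "\<And>g. g \<in> l2_sum I W \<Longrightarrow> norm (L g) \<le> C * l2_norm I g"
    and L: "\<And>g. g \<in> l2_sum I W \<Longrightarrow> ((\<lambda>i. v i *\<^sub>R g i) has_sum L g) I"
  shows "(\<lambda>i. (norm (analysis f i))\<^sup>2) summable_on I"
    and "(l2_norm I (analysis f))\<^sup>2 \<le> C\<^sup>2 * (norm f)\<^sup>2"
proof -
  have bound: "(\<Sum>i\<in>F. (norm (analysis f i))\<^sup>2) \<le> C\<^sup>2 * (norm f)\<^sup>2" if F: "finite F" "F \<subseteq> I" for F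
  proof -
    define g where "g i = (if i \<in> F then analysis f i else 0)" for i
    define s where "s = (\<Sum>i\<in>F. (norm (analysis f i))\<^sup>2)"
    have sq: "((\<lambda>i. (norm (g i))\<^sup>2) has_sum s) I"
      unfolding s_def using has_sum_finite[OF F(1)]
      by (rule has_sum_cong_neutral[THEN iffD1, rotated 3]) (use F in \<open>auto simp: g_def\<close>)
    then have g: "g \<in> l2_sum I W"
      using F analysis_in_W real_vector.subspace_0[OF W_real_subspace]
      by (auto simp: l2_sum_def g_def dest: has_sum_imp_summable)
    have "((\<lambda>i. v i *\<^sub>R g i) has_sum (\<Sum>i\<in>F. v i *\<^sub>R analysis f i)) I"
      using has_sum_finite[OF F(1)]
      by (rule has_sum_cong_neutral[THEN iffD1, rotated 3]) (use F in \<open>auto simp: g_def\<close>)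
    then have Lg: "L g = (\<Sum>i\<in>F. v i *\<^sub>R analysis f i)" using L[OF g] has_sum_unique by blast
    have "s = rip (L g) f"
      using sum_rip_analysis[of "analysis f" F f] F analysis_in_W by (simp add: Lg s_def rip_self)
    also have "\<dots> \<le> norm (L g) * norm f" using rip_Cauchy_Schwarz[of "L g" f] by simp
    also have "\<dots> \<le> (C * l2_norm I g) * norm f" by (intro mult_right_mono C g) simp
    also have "l2_norm I g = sqrt s" using infsumI[OF sq] by (simp add: l2_norm_def)
    finally have "s \<le> (C * norm f) * sqrt s" by (simp add: mult_ac)
    moreover have "0 \<le> s" by (simp add: s_def sum_nonneg)
    ultimately have le: "sqrt s * sqrt s \<le> (C * norm f) * sqrt s" by simp
    have "sqrt s \<le> C * norm f"
    proof (cases "s = 0")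
      case False
      then show ?thesis using \<open>0 \<le> s\<close> by (intro mult_right_le_imp_le[OF le]) simp
    qed (use C(1) in simp)
    then have "(sqrt s)\<^sup>2 \<le> (C * norm f)\<^sup>2" by (intro power_mono) (simp_all add: \<open>0 \<le> s\<close>)
    then show ?thesis using \<open>0 \<le> s\<close> by (simp add: s_def power_mult_distrib)
  qed
  show summable: "(\<lambda>i. (norm (analysis f i))\<^sup>2) summable_on I"
    by (rule nonneg_bdd_above_summable_on) (auto intro!: bdd_aboveI2[of _ _ "C\<^sup>2 * (norm f)\<^sup>2"] bound)
  show "(l2_norm I (analysis f))\<^sup>2 \<le> C\<^sup>2 * (norm f)\<^sup>2"
    unfolding l2_norm_power2 by (rule infsum_le_finite_sums[OF summable bound])
qed

text \<open>A preimage \<open>g\<close> of \<open>K x\<close> under \<open>L\<close> bounds the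
  functionals at \<open>x\<close> by \<open>l2_norm I g\<close>. The uniform bound is then evaluated
  at \<open>x = adjoint_op ip K f\<close>.\<close>

lemma lower_bound_if_range_subset:
  assumes K: "bounded_op smul K"
    and summable: "\<And>f. (\<lambda>i. (norm (analysis f i))\<^sup>2) summable_on I"
    and L: "\<And>g. g \<in> l2_sum I W \<Longrightarrow> ((\<lambda>i. v i *\<^sub>R g i) has_sum L g) I"
    and range: "range K \<subseteq> L ` l2_sum I W"
  obtains C where "0 \<le> C" "\<And>f. norm (adjoint_op ip K f) \<le> C * l2_norm I (analysis f)"
proof -
  interpret K: bounded_linear K using K by (simp add: bounded_op_def)
  let ?S = "{f. l2_norm I (analysis f) \<le> 1}"
  obtain C where C: "0 \<le> C" "\<And>f x. f \<in> ?S \<Longrightarrow> norm (rip (K x) f) \<le> C * norm x"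
  proof (rule uniform_boundedness[of ?S "\<lambda>f x. rip (K x) f"])
    show "bounded_linear (\<lambda>x. rip (K x) f)" for f
      by (rule bounded_linear_compose[OF bounded_linear_rip_left K.bounded_linear_axioms])
    show "\<exists>c. \<forall>f\<in>?S. norm (rip (K x) f) \<le> c" for x
    proof -
      obtain g where g: "g \<in> l2_sum I W" "K x = L g" using range by blast
      have "norm (rip (K x) f) \<le> l2_norm I g" if "f \<in> ?S" for f
      proof -
        have "\<bar>rip (K x) f\<bar> \<le> l2_norm I g * l2_norm I (analysis f)"
          unfolding g(2) by (rule rip_le_l2_norm_analysis[OF g(1) L[OF g(1)] summable])
        also have "\<dots> \<le> l2_norm I g * 1" using that by (intro mult_left_mono) auto
        finally show ?thesis by simp
      qed
      then show ?thesis by blast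
    qed
  qed (use that in blast)
  have "norm (adjoint_op ip K f) \<le> C * l2_norm I (analysis f)" for f
  proof (rule field_le_epsilon)
    fix \<epsilon> :: real assume "0 < \<epsilon>"
    \<comment> \<open>\<open>l2_norm I (analysis f)\<close> may be 0, so \<open>f\<close> is
      normalised by a slightly larger \<open>q\<close>; after multiplication by \<open>C\<close> the
      excess is at most \<open>\<epsilon>\<close>.\<close>
    define q where "q = l2_norm I (analysis f) + \<epsilon> / (C + 1)"
    have q: "l2_norm I (analysis f) \<le> q" "0 < q"
      using C(1) \<open>0 < \<epsilon>\<close> by (auto simp: q_def intro: add_nonneg_pos)
    have "l2_norm I (analysis ((1 / q) *\<^sub>R f)) = l2_norm I (analysis f) / q"
    proof -
      have "(l2_norm I (analysis ((1 / q) *\<^sub>R f)))\<^sup>2 = (l2_norm I (analysis f) / q)\<^sup>2"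
        using q(2)
        by (simp add: power_divide l2_norm_power2 linear_cmul[OF linear_analysis]
            power_mult_distrib infsum_cmult_right' divide_inverse mult.commute)
      then show ?thesis by (rule power2_eq_imp_eq) (use q in auto)
    qed
    then have "(1 / q) *\<^sub>R f \<in> ?S" using q by simp
    \<comment> \<open>At this vector the product with \<open>f\<close> is the square of
      \<open>norm (adjoint_op ip K f)\<close>, one factor of which cancels.\<close>
    from C(2)[OF this, of "adjoint_op ip K f"]
    have "\<bar>rip (K (adjoint_op ip K f)) f\<bar> \<le> C * norm (adjoint_op ip K f) * q"
      using q by (simp add: bilinear_rmul[OF bilinear_rip] field_simps)
    then have "norm (adjoint_op ip K f) * norm (adjoint_op ip K f) \<le> (C * q) * norm (adjoint_op ip K f)"
      by (simp add: rip_adjoint_op[OF K] rip_self power2_eq_square mult_ac)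
    then have "norm (adjoint_op ip K f) \<le> C * q"
      using C(1) q by (cases "adjoint_op ip K f = 0") auto
    also have "\<dots> = C * l2_norm I (analysis f) + C / (C + 1) * \<epsilon>" by (simp add: q_def field_simps)
    also have "C / (C + 1) * \<epsilon> \<le> 1 * \<epsilon>" using C(1) \<open>0 < \<epsilon>\<close> by (intro mult_right_mono) auto
    finally show "norm (adjoint_op ip K f) \<le> C * l2_norm I (analysis f) + \<epsilon>" by simp
  qed
  then show thesis using that C(1) by blast
qed

lemma K_fusion_frame_iff:
  "K_fusion_frame ip K I W v \<longleftrightarrow>
     (\<exists>A>0. \<exists>B>0. \<forall>f. (\<lambda>i. (norm (analysis f i))\<^sup>2) summable_on I \<and>
        A * (norm (adjoint_op ip K f))\<^sup>2 \<le> (l2_norm I (analysis f))\<^sup>2 \<and>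
        (l2_norm I (analysis f))\<^sup>2 \<le> B * (norm f)\<^sup>2)"
  unfolding K_fusion_frame_def l2_norm_analysis analysis_summable_iff ..

end

section \<open>K-fusion frames characterised by range inclusion\<close>

theorem theorem4p5:
  fixes smul :: "'k::real_or_complex \<Rightarrow> 'h::banach \<Rightarrow> 'h"
    and ip :: "'h \<Rightarrow> 'h \<Rightarrow> 'k"
    and K :: "'h \<Rightarrow> 'h"
    and I :: "'i set"
    and W :: "'i \<Rightarrow> 'h set"
    and v :: "'i \<Rightarrow> real"
  assumes "hilbert_space smul ip"
    and separable: "\<exists>D :: 'h set. countable D \<and> closure D = UNIV"
    and "bounded_op smul K"
    and "countable I"
    and "\<And>i. i \<in> I \<Longrightarrow> closed_subspace smul (W i)"
    and "\<And>i. i \<in> I \<Longrightarrow> v i > 0"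
  shows "K_fusion_frame ip K I W v \<longleftrightarrow>
    (\<exists>L. l2_bounded_op smul I W L \<and>
         (\<forall>N e. l2_orthonormal_basis smul ip I W N e \<longrightarrow>
            (\<forall>n\<in>N. ((\<lambda>i. v i *\<^sub>R e n i) has_sum L (e n)) I)) \<and>
         range K \<subseteq> L ` l2_sum I W)"
    (is "_ \<longleftrightarrow> (\<exists>L. ?op L)")
proof -
  interpret weighted_subspaces smul ip I W v
    using assms by (simp add: weighted_subspaces_def weighted_subspaces_axioms_def)
  show ?thesis
  proof
    assume "K_fusion_frame ip K I W v"
    then obtain A B where "0 < A" "0 < B"
      and summable: "\<And>f. (\<lambda>i. (norm (analysis f i))\<^sup>2) summable_on I"
      and lower: "\<And>f. A * (norm (adjoint_op ip K f))\<^sup>2 \<le> (l2_norm I (analysis f))\<^sup>2"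
      and upper: "\<And>f. (l2_norm I (analysis f))\<^sup>2 \<le> B * (norm f)\<^sup>2"
      unfolding K_fusion_frame_iff by blast
    interpret bessel_subspaces smul ip I W v B
      by unfold_locales (use \<open>0 < B\<close> summable upper in auto)
    \<comment> \<open>Basis vectors lie in the direct sum, so the condition on bases is an instance
      of \<open>has_sum_synthesis\<close>.\<close>
    have "?op synthesis"
      using l2_bounded_op_synthesis has_sum_synthesis
        range_subset_if_lower_bound[OF \<open>bounded_op smul K\<close> \<open>0 < A\<close> lower]
      by (simp add: l2_orthonormal_basis_def)
    then show "\<exists>L. ?op L" by blast
  next
    assume "\<exists>L. ?op L"
    then obtain L where L: "l2_bounded_op smul I W L"
      and basis: "\<And>N e n. l2_orthonormal_basis smul ip I W N e \<Longrightarrow> n \<in> N \<Longrightarrow>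
            ((\<lambda>i. v i *\<^sub>R e n i) has_sum L (e n)) I"
      and range: "range K \<subseteq> L ` l2_sum I W"
      by blast
    \<comment> \<open>From here on \<open>L\<close> is known to be the synthesis operator on the
      whole direct sum.\<close>
    have L_sum: "((\<lambda>i. v i *\<^sub>R g i) has_sum L g) I" if "g \<in> l2_sum I W" for g
      by (rule has_sum_if_basis[OF \<open>countable I\<close> separable L _ that]) (rule basis)
    obtain C0 where C0: "\<And>f. f \<in> l2_sum I W \<Longrightarrow> norm (L f) \<le> C0 * l2_norm I f"
      using L unfolding l2_bounded_op_def by blast
    \<comment> \<open>Positivity makes the square of \<open>C\<close> an admissible upper frame
      bound.\<close>
    define C where "C = max C0 1"
    have C: "norm (L f) \<le> C * l2_norm I f" if "f \<in> l2_sum I W" for f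
      using C0[OF that] mult_right_mono[of C0 C "l2_norm I f"] by (simp add: C_def)
    have "0 < C" by (simp add: C_def)
    note bessel = bessel_if_bounded[OF less_imp_le[OF \<open>0 < C\<close>] C L_sum]
    obtain c where c: "0 \<le> c" "\<And>f. norm (adjoint_op ip K f) \<le> c * l2_norm I (analysis f)"
      using lower_bound_if_range_subset[OF \<open>bounded_op smul K\<close> bessel(1) L_sum range] by blast
    \<comment> \<open>The added 1 yields a positive lower frame bound even for
      \<open>c = 0\<close>.\<close>
    have "1 / (c\<^sup>2 + 1) * (norm (adjoint_op ip K f))\<^sup>2 \<le> (l2_norm I (analysis f))\<^sup>2" for f
    proof -
      have "(norm (adjoint_op ip K f))\<^sup>2 \<le> (c * l2_norm I (analysis f))\<^sup>2"
        by (intro power_mono c) simp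
      also have "\<dots> \<le> (c\<^sup>2 + 1) * (l2_norm I (analysis f))\<^sup>2"
        by (simp add: power_mult_distrib algebra_simps)
      finally show ?thesis by (simp add: divide_le_eq add_pos_nonneg mult.commute add_nonneg_pos)
    qed
    moreover have "0 < 1 / (c\<^sup>2 + 1)" by (simp add: add_nonneg_pos)
    ultimately show "K_fusion_frame ip K I W v"
      unfolding K_fusion_frame_iff using bessel \<open>0 < C\<close> zero_less_power[of C 2] by blast
  qed
qed

end
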